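(* Let $\Delta$ be a visibility function and $P$ a closed process with $\Delta\vdash P$, and suppose $P\xrightarrow{\mu}P'$. Then: (i) if $\mu=\tau$ or $\mu$ is a first-order input $h\langle v\rangle$, then $\Delta\vdash P'$; the same holds if $\mu$ is a first-order output $\overline h\langle v\rangle$ and $\mathsf{cur}\notin\mathrm{dom}\Delta$; (ii) if $\mu=\overline a\langle v\rangle(b)$ then $a\in\Delta(\mathsf{cur})$ and $(\Delta\setminus\mathsf{cur}),b\mapsto\Delta(\mathsf{cur})\cup\{b\}\vdash P'$; (iii) if $\mu=a\langle v\rangle(b)$ and $\mathsf{cur}\notin\mathrm{dom}\Delta$, then $\Delta,\mathsf{cur}\mapsto\Delta(a)\cup\{b\}\vdash P'$.
   Context: Calculus. Names are partitioned into higher-order names $a,b,c,d,\dots$ (set $N_{ho}$), first-order names $h,k$, and success names $\omega$. There are first-order values $v$, first-order variables $x$, first-order expressions $e,f$; closed expressions evaluate to values ($e\Downarrow v$). Processes: $P::= a(x,b).P \mid h(x).P \mid \overline{a}\langle e\rangle(b).P \mid \overline{h}\langle e\rangle.P \mid \omega.P \mid\ !\alpha.P \mid P|Q \mid \nu a\,P \mid \nu h\,P \mid 0 \mid P+Q \mid \mathtt{if}\ e=f\ \mathtt{then}\ P\ \mathtt{else}\ Q$, $\alpha$ an input prefix $a(x,b)$ or $h(x)$; $x,b$ bound in $a(x,b).P$, $x$ in $h(x).P$, $b$ in $\overline a\langle e\rangle(b).P$ (output of $e$ with a fresh name $b$); restrictions bind; processes closed, up to $\alpha$-conversion. Actions $\mu::=\tau\mid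 a\langle v\rangle(b)\mid \overline a\langle v\rangle(b)\mid h\langle v\rangle\mid \overline h\langle v\rangle\mid\omega$. Transitions: $a(x,b).P\xrightarrow{a\langle v\rangle(b)}P[v/x]$; $\overline a\langle e\rangle(b).P\xrightarrow{\overline a\langle v\rangle(b)}P$ if $e\Downarrow v$; $h(x).P\xrightarrow{h\langle v\rangle}P[v/x]$; $\overline h\langle e\rangle.P\xrightarrow{\overline h\langle v\rangle}P$ if $e\Downarrow v$; $\omega.P\xrightarrow{\omega}0$; if $\alpha.P\xrightarrow{\mu}Q$ then $!\alpha.P\xrightarrow{\mu}Q|!\alpha.P$; $\nu n P\xrightarrow{\mu}\nu nP'$ if $P\xrightarrow{\mu}P'$, $n$ not free in $\mu$; $P+Q\xrightarrow{\mu}P'$ if $P\xrightarrow{\mu}P'$; $P|Q\xrightarrow{\tau}\nu b(P'|Q')$ if $P\xrightarrow{a\langle v\rangle(b)}P'$, $Q\xrightarrow{\overline a\langle v\rangle(b)}Q'$; $P|Q\xrightarrow{\tau}P'|Q'$ if $P\xrightarrow{h\langle v\rangle}P'$, $Q\xrightarrow{\overline h\langle v\rangle}Q'$; $P|Q\xrightarrow{\mu}P'|Q$ if $P\xrightarrow{\mu}P'$ and bound names of $\mu$ not free in $Q$; symmetric versions; the conditional behaves as $P$ if $e,f$ evaluate to the same value and as $Q$ otherwise. A visibility function is a finite partial function $\Delta:N_{ho}\cup\{\mathsf{cur}\}\to\mathcal P_{fin}(N_{ho})$ that is transitive: for $o\in\mathrm{dom}\Delta$, $a\in\mathrm{dom}\Delta$,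 $a\in\Delta(o)$ implies $\Delta(a)\subseteq\Delta(o)$. $\Delta,p\mapsto V$ extends $\Delta$ ($p\notin\mathrm{dom}\Delta$); $\Delta\setminus p$ erases $p$ from domain and from all values; $\Delta_1\cup\Delta_2$: union of domains, pointwise union of values; $(\Delta_1,\Delta_2)\in\mathrm{split}(\Delta)$ iff $\Delta_1\cup\Delta_2=\Delta$ and $\mathsf{cur}\notin\mathrm{dom}\Delta_1\cap\mathrm{dom}\Delta_2$. Typing $\Delta\vdash P$ is the least relation with: $\Delta\vdash\overline a\langle e\rangle(b).P$ if $a\in\Delta(\mathsf{cur})$ and $(\Delta\setminus\mathsf{cur}),b\mapsto\Delta(\mathsf{cur})\cup\{b\}\vdash P$; $\Delta\vdash a(x,b).P$ if $\mathsf{cur}\notin\mathrm{dom}\Delta$, $a\in\mathrm{dom}\Delta$ and $\Delta,\mathsf{cur}\mapsto\Delta(a)\cup\{b\}\vdash P$; $\Delta\vdash\overline h\langle e\rangle.P$ if $\Delta\vdash P$, $\mathsf{cur}\notin\mathrm{dom}\Delta$; $\Delta\vdash h(x).P$ if $\Delta\vdash P$, $\mathsf{cur}\in\mathrm{dom}\Delta$; $\Delta\vdash!\alpha.P$ if $\Delta\vdash\alpha.P$, $\mathsf{cur}\notin\mathrm{dom}\Delta$; $\Delta\vdash\omega.P$ always; $\Delta\setminus a\vdash\nu aP$ if $\Delta\vdash P$; $\Delta\vdash\nu hP$ if $\Delta\vdash P$; $\Delta\vdash0$ if $\mathsf{cur}\notin\mathrm{dom}\Delta$; sum and conditional typed if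 both branches are typed under $\Delta$; $\Delta\vdash P_1|P_2$ if $\Delta_i\vdash P_i$ with $(\Delta_1,\Delta_2)\in\mathrm{split}(\Delta)$.
   Formalization: Bound names are kept fresh: in actions b differs from a and from restricted names crossed, the typing rules for higher-order prefixes take b outside all names in Δ, and the typings of P' in (ii),(iii) are claimed for b not occurring in Δ (else the extension need not be a visibility function). *)

theory Defs
  imports "HOL-Combinatorics.Transposition"
begin

section \<open>Names, expressions, raw terms\<close>

datatype hname = HName nat   \<comment> \<open>higher-order names\<close>
datatype fname = FName nat   \<comment> \<open>first-order names\<close>
datatype sname = SName nat   \<comment> \<open>success names\<close>
datatype fvar = FVar nat     \<comment> \<open>first-order variables\<close>

text \<open>
  The language of first-order expressions is left open: terms over arbitrary types of operators
  \<open>'f\<close> and of values \<open>'v\<close>. Evaluation of closed expressions is a parameter of the calculus.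
\<close>

datatype ('f, 'v) expr = Var fvar | Val 'v | App 'f "('f, 'v) expr list"

primrec fv_expr :: "('f, 'v) expr \<Rightarrow> fvar set" where
  "fv_expr (Var x) = {x}"
| "fv_expr (Val v) = {}"
| "fv_expr (App f es) = \<Union> (set (map fv_expr es))"

primrec ren_expr :: "(fvar \<Rightarrow> fvar) \<Rightarrow> ('f, 'v) expr \<Rightarrow> ('f, 'v) expr" where
  "ren_expr r (Var x) = Var (r x)"
| "ren_expr r (Val v) = Val v"
| "ren_expr r (App f es) = App f (map (ren_expr r) es)"

primrec subst_expr :: "fvar \<Rightarrow> 'v \<Rightarrow> ('f, 'v) expr \<Rightarrow> ('f, 'v) expr" where
  "subst_expr x v (Var y) = (if y = x then Val v else Var y)"
| "subst_expr x v (Val w) = Val w"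
| "subst_expr x v (App f es) = App f (map (subst_expr x v) es)"

definition evaluation :: "(('f, 'v) expr \<Rightarrow> 'v \<Rightarrow> bool) \<Rightarrow> bool" where
  "evaluation ev \<longleftrightarrow>
     (\<forall>e v. ev e v \<longrightarrow> fv_expr e = {}) \<and>
     (\<forall>e. fv_expr e = {} \<longrightarrow> (\<exists>!v. ev e v)) \<and>
     (\<forall>v. ev (Val v) v)"

text \<open>Input prefixes: \<open>HIn a x b\<close> is $a(x,b)$, \<open>FIn h x\<close> is $h(x)$.\<close>

datatype inprefix = HIn hname fvar hname | FIn fname fvar

datatype ('f, 'v) raw =
    RNil
  | RInp inprefix "('f, 'v) raw"
  | ROut hname "('f, 'v) expr" hname "('f, 'v) raw"
  | RFOut fname "('f, 'v) expr" "('f, 'v) raw"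
  | RSucc sname "('f, 'v) raw"
  | RBang inprefix "('f, 'v) raw"
  | RPar "('f, 'v) raw" "('f, 'v) raw"
  | RNuH hname "('f, 'v) raw"
  | RNuF fname "('f, 'v) raw"
  | RSum "('f, 'v) raw" "('f, 'v) raw"
  | RIf "('f, 'v) expr" "('f, 'v) expr" "('f, 'v) raw" "('f, 'v) raw"

primrec bvp :: "inprefix \<Rightarrow> fvar" where
  "bvp (HIn a x b) = x"
| "bvp (FIn h x) = x"

primrec rfnh :: "('f, 'v) raw \<Rightarrow> hname set" where
  "rfnh RNil = {}"
| "rfnh (RInp \<alpha> P) = (case \<alpha> of HIn a x b \<Rightarrow> {a} \<union> (rfnh P - {b}) | FIn h x \<Rightarrow> rfnh P)"
| "rfnh (ROut a e b P) = {a} \<union> (rfnh P - {b})"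
| "rfnh (RFOut h e P) = rfnh P"
| "rfnh (RSucc w P) = rfnh P"
| "rfnh (RBang \<alpha> P) = (case \<alpha> of HIn a x b \<Rightarrow> {a} \<union> (rfnh P - {b}) | FIn h x \<Rightarrow> rfnh P)"
| "rfnh (RPar P Q) = rfnh P \<union> rfnh Q"
| "rfnh (RNuH a P) = rfnh P - {a}"
| "rfnh (RNuF h P) = rfnh P"
| "rfnh (RSum P Q) = rfnh P \<union> rfnh Q"
| "rfnh (RIf e f P Q) = rfnh P \<union> rfnh Q"

primrec rfnf :: "('f, 'v) raw \<Rightarrow> fname set" where
  "rfnf RNil = {}"
| "rfnf (RInp \<alpha> P) = (case \<alpha> of HIn a x b \<Rightarrow> rfnf P | FIn h x \<Rightarrow> {h} \<union> rfnf P)"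
| "rfnf (ROut a e b P) = rfnf P"
| "rfnf (RFOut h e P) = {h} \<union> rfnf P"
| "rfnf (RSucc w P) = rfnf P"
| "rfnf (RBang \<alpha> P) = (case \<alpha> of HIn a x b \<Rightarrow> rfnf P | FIn h x \<Rightarrow> {h} \<union> rfnf P)"
| "rfnf (RPar P Q) = rfnf P \<union> rfnf Q"
| "rfnf (RNuH a P) = rfnf P"
| "rfnf (RNuF h P) = rfnf P - {h}"
| "rfnf (RSum P Q) = rfnf P \<union> rfnf Q"
| "rfnf (RIf e f P Q) = rfnf P \<union> rfnf Q"

primrec rfv :: "('f, 'v) raw \<Rightarrow> fvar set" where
  "rfv RNil = {}"
| "rfv (RInp \<alpha> P) = rfv P - {bvp \<alpha>}"
| "rfv (ROut a e b P) = fv_expr e \<union> rfv P"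
| "rfv (RFOut h e P) = fv_expr e \<union> rfv P"
| "rfv (RSucc w P) = rfv P"
| "rfv (RBang \<alpha> P) = rfv P - {bvp \<alpha>}"
| "rfv (RPar P Q) = rfv P \<union> rfv Q"
| "rfv (RNuH a P) = rfv P"
| "rfv (RNuF h P) = rfv P"
| "rfv (RSum P Q) = rfv P \<union> rfv Q"
| "rfv (RIf e f P Q) = fv_expr e \<union> fv_expr f \<union> rfv P \<union> rfv Q"

text \<open>
  \<open>ren\<close> renames every occurrence, binding ones included; it is only used with permutations.
\<close>

primrec ren_pre ::
  "(hname \<Rightarrow> hname) \<Rightarrow> (fname \<Rightarrow> fname) \<Rightarrow> (fvar \<Rightarrow> fvar) \<Rightarrow> inprefix \<Rightarrow> inprefix" where
  "ren_pre p q r (HIn a x b) = HIn (p a) (r x) (p b)"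
| "ren_pre p q r (FIn h x) = FIn (q h) (r x)"

primrec ren ::
  "(hname \<Rightarrow> hname) \<Rightarrow> (fname \<Rightarrow> fname) \<Rightarrow> (fvar \<Rightarrow> fvar) \<Rightarrow> ('f, 'v) raw \<Rightarrow> ('f, 'v) raw" where
  "ren p q r RNil = RNil"
| "ren p q r (RInp \<alpha> P) = RInp (ren_pre p q r \<alpha>) (ren p q r P)"
| "ren p q r (ROut a e b P) = ROut (p a) (ren_expr r e) (p b) (ren p q r P)"
| "ren p q r (RFOut h e P) = RFOut (q h) (ren_expr r e) (ren p q r P)"
| "ren p q r (RSucc w P) = RSucc w (ren p q r P)"
| "ren p q r (RBang \<alpha> P) = RBang (ren_pre p q r \<alpha>) (ren p q r P)"
| "ren p q r (RPar P Q) = RPar (ren p q r P) (ren p q r Q)"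
| "ren p q r (RNuH a P) = RNuH (p a) (ren p q r P)"
| "ren p q r (RNuF h P) = RNuF (q h) (ren p q r P)"
| "ren p q r (RSum P Q) = RSum (ren p q r P) (ren p q r Q)"
| "ren p q r (RIf e f P Q) = RIf (ren_expr r e) (ren_expr r f) (ren p q r P) (ren p q r Q)"

text \<open>Values contain neither names nor variables, so this substitution cannot capture.\<close>

primrec rsubst :: "fvar \<Rightarrow> 'v \<Rightarrow> ('f, 'v) raw \<Rightarrow> ('f, 'v) raw" where
  "rsubst x v RNil = RNil"
| "rsubst x v (RInp \<alpha> P) = RInp \<alpha> (if bvp \<alpha> = x then P else rsubst x v P)"
| "rsubst x v (ROut a e b P) = ROut a (subst_expr x v e) b (rsubst x v P)"
| "rsubst x v (RFOut h e P) = RFOut h (subst_expr x v e) (rsubst x v P)"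
| "rsubst x v (RSucc w P) = RSucc w (rsubst x v P)"
| "rsubst x v (RBang \<alpha> P) = RBang \<alpha> (if bvp \<alpha> = x then P else rsubst x v P)"
| "rsubst x v (RPar P Q) = RPar (rsubst x v P) (rsubst x v Q)"
| "rsubst x v (RNuH a P) = RNuH a (rsubst x v P)"
| "rsubst x v (RNuF h P) = RNuF h (rsubst x v P)"
| "rsubst x v (RSum P Q) = RSum (rsubst x v P) (rsubst x v Q)"
| "rsubst x v (RIf e f P Q) = RIf (subst_expr x v e) (subst_expr x v f) (rsubst x v P) (rsubst x v Q)"


section \<open>Alpha-conversion and processes\<close>

abbreviation swap_h :: "hname \<Rightarrow> hname \<Rightarrow> ('f, 'v) raw \<Rightarrow> ('f, 'v) raw" where
  "swap_h a b \<equiv> ren (transpose a b) id id"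

abbreviation swap_f :: "fname \<Rightarrow> fname \<Rightarrow> ('f, 'v) raw \<Rightarrow> ('f, 'v) raw" where
  "swap_f h k \<equiv> ren id (transpose h k) id"

abbreviation swap_v :: "fvar \<Rightarrow> fvar \<Rightarrow> ('f, 'v) raw \<Rightarrow> ('f, 'v) raw" where
  "swap_v x y \<equiv> ren id id (transpose x y)"

inductive aeq :: "('f, 'v) raw \<Rightarrow> ('f, 'v) raw \<Rightarrow> bool" where
  aeq_refl: "aeq P P"
| aeq_sym: "aeq P Q \<Longrightarrow> aeq Q P"
| aeq_trans: "aeq P Q \<Longrightarrow> aeq Q R \<Longrightarrow> aeq P R"
| aeq_Inp: "aeq P Q \<Longrightarrow> aeq (RInp \<alpha> P) (RInp \<alpha> Q)"
| aeq_Out: "aeq P Q \<Longrightarrow> aeq (ROut a e b P) (ROut a e b Q)"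
| aeq_FOut: "aeq P Q \<Longrightarrow> aeq (RFOut h e P) (RFOut h e Q)"
| aeq_Succ: "aeq P Q \<Longrightarrow> aeq (RSucc w P) (RSucc w Q)"
| aeq_Bang: "aeq P Q \<Longrightarrow> aeq (RBang \<alpha> P) (RBang \<alpha> Q)"
| aeq_Par: "aeq P Q \<Longrightarrow> aeq P' Q' \<Longrightarrow> aeq (RPar P P') (RPar Q Q')"
| aeq_NuH: "aeq P Q \<Longrightarrow> aeq (RNuH a P) (RNuH a Q)"
| aeq_NuF: "aeq P Q \<Longrightarrow> aeq (RNuF h P) (RNuF h Q)"
| aeq_Sum: "aeq P Q \<Longrightarrow> aeq P' Q' \<Longrightarrow> aeq (RSum P P') (RSum Q Q')"
| aeq_If: "aeq P Q \<Longrightarrow> aeq P' Q' \<Longrightarrow> aeq (RIf e f P P') (RIf e f Q Q')"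
| aeq_ren_InpH: "c \<notin> rfnh P \<Longrightarrow> aeq (RInp (HIn a x b) P) (RInp (HIn a x c) (swap_h b c P))"
| aeq_ren_InpHV: "y \<notin> rfv P \<Longrightarrow> aeq (RInp (HIn a x b) P) (RInp (HIn a y b) (swap_v x y P))"
| aeq_ren_InpFV: "y \<notin> rfv P \<Longrightarrow> aeq (RInp (FIn h x) P) (RInp (FIn h y) (swap_v x y P))"
| aeq_ren_BangH: "c \<notin> rfnh P \<Longrightarrow> aeq (RBang (HIn a x b) P) (RBang (HIn a x c) (swap_h b c P))"
| aeq_ren_BangHV: "y \<notin> rfv P \<Longrightarrow> aeq (RBang (HIn a x b) P) (RBang (HIn a y b) (swap_v x y P))"
| aeq_ren_BangFV: "y \<notin> rfv P \<Longrightarrow> aeq (RBang (FIn h x) P) (RBang (FIn h y) (swap_v x y P))"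
| aeq_ren_Out: "c \<notin> rfnh P \<Longrightarrow> aeq (ROut a e b P) (ROut a e c (swap_h b c P))"
| aeq_ren_NuH: "c \<notin> rfnh P \<Longrightarrow> aeq (RNuH a P) (RNuH c (swap_h a c P))"
| aeq_ren_NuF: "k \<notin> rfnf P \<Longrightarrow> aeq (RNuF h P) (RNuF k (swap_f h k P))"

lemma fv_ren_expr: "fv_expr (ren_expr r e) = r ` fv_expr e"
  by (induction e) auto

lemma subst_expr_fresh: "x \<notin> fv_expr e \<Longrightarrow> subst_expr x v e = e"
  by (induction e) (auto simp: map_idI)

lemma subst_ren_expr: "inj r \<Longrightarrow> subst_expr (r x) v (ren_expr r e) = ren_expr r (subst_expr x v e)"
  by (induction e) (auto simp: inj_eq)

lemma fv_subst_expr: "fv_expr (subst_expr x v e) = fv_expr e - {x}"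
  by (induction e) auto

lemma rfnh_ren: "inj p \<Longrightarrow> rfnh (ren p q r P) = p ` rfnh P"
  by (induction P) (auto simp: image_Un image_set_diff split: inprefix.splits)

lemma rfnf_ren: "inj q \<Longrightarrow> rfnf (ren p q r P) = q ` rfnf P"
  by (induction P) (auto simp: image_Un image_set_diff split: inprefix.splits)

lemma bvp_ren: "bvp (ren_pre p q r \<alpha>) = r (bvp \<alpha>)"
  by (cases \<alpha>) auto

lemma rfv_ren: "inj r \<Longrightarrow> rfv (ren p q r P) = r ` rfv P"
  by (induction P) (auto simp: image_Un image_set_diff fv_ren_expr bvp_ren)

lemma rsubst_fresh: "x \<notin> rfv P \<Longrightarrow> rsubst x v P = P"
  by (induction P) (auto simp: subst_expr_fresh)

lemma rsubst_ren: "inj r \<Longrightarrow> rsubst (r x) v (ren p q r P) = ren p q r (rsubst x v P)"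
  by (induction P) (auto simp: subst_ren_expr bvp_ren inj_eq)

lemma rfnh_rsubst: "rfnh (rsubst x v P) = rfnh P"
  by (induction P) (auto split: inprefix.splits)

lemma rfnf_rsubst: "rfnf (rsubst x v P) = rfnf P"
  by (induction P) (auto split: inprefix.splits)

lemma rfv_rsubst: "rfv (rsubst x v P) = rfv P - {x}"
  by (induction P) (auto simp: fv_subst_expr)

lemma image_transpose_diff:
  "c \<notin> A \<Longrightarrow> transpose b c ` A - {c} = A - {b}"
  by (auto simp: transpose_def image_iff split: if_splits)

lemma aeq_rfnh: "aeq P Q \<Longrightarrow> rfnh P = rfnh Q"
  by (induction rule: aeq.induct)
    (auto simp: rfnh_ren image_transpose_diff split: inprefix.splits)

lemma aeq_rfnf: "aeq P Q \<Longrightarrow> rfnf P = rfnf Q"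
  by (induction rule: aeq.induct)
    (auto simp: rfnf_ren image_transpose_diff split: inprefix.splits)

lemma aeq_rfv: "aeq P Q \<Longrightarrow> rfv P = rfv Q"
  by (induction rule: aeq.induct)
    (auto simp: rfv_ren image_transpose_diff)

lemma rsubst_swap_v:
  assumes "y \<notin> rfv P"
  shows "(if x = z then P else rsubst z v P) = P' \<Longrightarrow>
    (if y = z then swap_v x y P else rsubst z v (swap_v x y P)) = swap_v x y P' \<and> y \<notin> rfv P'"
proof -
  assume P': "(if x = z then P else rsubst z v P) = P'"
  consider "y = z" | "y \<noteq> z" "x = z" | "y \<noteq> z" "x \<noteq> z" by blast
  then show ?thesis
  proof cases
    case 1
    then show ?thesis using assms P' by (auto simp: rsubst_fresh split: if_splits)
  next
    case 2
    then have "z \<notin> rfv (swap_v x y P)"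
      using assms by (auto simp: rfv_ren transpose_def split: if_splits)
    then show ?thesis using 2 assms P' by (auto simp: rsubst_fresh)
  next
    case 3
    then show ?thesis
      using assms P' rsubst_ren[of "transpose x y" z v id id P] by (auto simp: rfv_rsubst)
  qed
qed

lemma aeq_rsubst: "aeq P Q \<Longrightarrow> aeq (rsubst z v P) (rsubst z v Q)"
proof (induction rule: aeq.induct)
  case (aeq_trans P Q R)
  then show ?case by (blast intro: aeq.aeq_trans)
next
  case (aeq_ren_InpH c P a x b)
  then show ?case
    using rsubst_ren[of id z v "transpose b c" id P]
    by (auto simp: rfnh_rsubst intro: aeq.aeq_ren_InpH)
next
  case (aeq_ren_BangH c P a x b)
  then show ?case
    using rsubst_ren[of id z v "transpose b c" id P]
    by (auto simp: rfnh_rsubst intro: aeq.aeq_ren_BangH)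
next
  case (aeq_ren_Out c P a e b)
  then show ?case
    using rsubst_ren[of id z v "transpose b c" id P]
    by (auto simp: rfnh_rsubst intro: aeq.aeq_ren_Out)
next
  case (aeq_ren_NuH c P a)
  then show ?case
    using rsubst_ren[of id z v "transpose a c" id P]
    by (auto simp: rfnh_rsubst intro: aeq.aeq_ren_NuH)
next
  case (aeq_ren_NuF k P h)
  then show ?case
    using rsubst_ren[of id z v id "transpose h k" P]
    by (auto simp: rfnf_rsubst intro: aeq.aeq_ren_NuF)
next
  case (aeq_ren_InpHV y P a x b)
  from rsubst_swap_v[OF this refl, where x = x and z = z and v = v] show ?case
    by (simp only: rsubst.simps bvp.simps) (blast intro: aeq.aeq_ren_InpHV)
next
  case (aeq_ren_InpFV y P h x)
  from rsubst_swap_v[OF this refl, where x = x and z = z and v = v] show ?case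
    by (simp only: rsubst.simps bvp.simps) (blast intro: aeq.aeq_ren_InpFV)
next
  case (aeq_ren_BangHV y P a x b)
  from rsubst_swap_v[OF this refl, where x = x and z = z and v = v] show ?case
    by (simp only: rsubst.simps bvp.simps) (blast intro: aeq.aeq_ren_BangHV)
next
  case (aeq_ren_BangFV y P h x)
  from rsubst_swap_v[OF this refl, where x = x and z = z and v = v] show ?case
    by (simp only: rsubst.simps bvp.simps) (blast intro: aeq.aeq_ren_BangFV)
qed (auto intro: aeq.intros)

quotient_type ('f, 'v) proc = "('f, 'v) raw" / aeq
  by (intro equivpI reflpI sympI transpI) (blast intro: aeq_refl aeq_sym aeq_trans)+

lift_definition PNil :: "('f, 'v) proc" is RNil .
lift_definition Inp :: "inprefix \<Rightarrow> ('f, 'v) proc \<Rightarrow> ('f, 'v) proc" is RInp by (rule aeq_Inp)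
lift_definition Out :: "hname \<Rightarrow> ('f, 'v) expr \<Rightarrow> hname \<Rightarrow> ('f, 'v) proc \<Rightarrow> ('f, 'v) proc"
  is ROut by (rule aeq_Out)
lift_definition FOut :: "fname \<Rightarrow> ('f, 'v) expr \<Rightarrow> ('f, 'v) proc \<Rightarrow> ('f, 'v) proc"
  is RFOut by (rule aeq_FOut)
lift_definition Succ :: "sname \<Rightarrow> ('f, 'v) proc \<Rightarrow> ('f, 'v) proc" is RSucc by (rule aeq_Succ)
lift_definition Bang :: "inprefix \<Rightarrow> ('f, 'v) proc \<Rightarrow> ('f, 'v) proc" is RBang by (rule aeq_Bang)
lift_definition Par :: "('f, 'v) proc \<Rightarrow> ('f, 'v) proc \<Rightarrow> ('f, 'v) proc" is RPar by (rule aeq_Par)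
lift_definition NuH :: "hname \<Rightarrow> ('f, 'v) proc \<Rightarrow> ('f, 'v) proc" is RNuH by (rule aeq_NuH)
lift_definition NuF :: "fname \<Rightarrow> ('f, 'v) proc \<Rightarrow> ('f, 'v) proc" is RNuF by (rule aeq_NuF)
lift_definition PSum :: "('f, 'v) proc \<Rightarrow> ('f, 'v) proc \<Rightarrow> ('f, 'v) proc" is RSum by (rule aeq_Sum)
lift_definition Cond ::
  "('f, 'v) expr \<Rightarrow> ('f, 'v) expr \<Rightarrow> ('f, 'v) proc \<Rightarrow> ('f, 'v) proc \<Rightarrow> ('f, 'v) proc"
  is RIf by (rule aeq_If)

lift_definition fnh :: "('f, 'v) proc \<Rightarrow> hname set" is rfnh by (rule aeq_rfnh)
lift_definition fv :: "('f, 'v) proc \<Rightarrow> fvar set" is rfv by (rule aeq_rfv)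
lift_definition subst :: "fvar \<Rightarrow> 'v \<Rightarrow> ('f, 'v) proc \<Rightarrow> ('f, 'v) proc" is rsubst by (rule aeq_rsubst)

definition closed_proc :: "('f, 'v) proc \<Rightarrow> bool" where
  "closed_proc P \<longleftrightarrow> fv P = {}"


section \<open>Transitions\<close>

datatype 'v act =
    Tau
  | AIn hname 'v hname
  | AOut hname 'v hname
  | AFIn fname 'v
  | AFOut fname 'v
  | ASucc sname

fun bn :: "'v act \<Rightarrow> hname set" where
  "bn (AIn a v b) = {b}"
| "bn (AOut a v b) = {b}"
| "bn _ = {}"

fun hnames :: "'v act \<Rightarrow> hname set" where
  "hnames (AIn a v b) = {a, b}"
| "hnames (AOut a v b) = {a, b}"
| "hnames _ = {}"

fun fnames :: "'v act \<Rightarrow> fname set" where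
  "fnames (AFIn h v) = {h}"
| "fnames (AFOut h v) = {h}"
| "fnames _ = {}"

text \<open>
  Bound names are kept apart from all other names: in \<open>AIn a v b\<close> and \<open>AOut a v b\<close> the bound \<open>b\<close>
  differs from \<open>a\<close>, and a restricted name differs from the bound name of an action crossing the
  restriction. Without this, \<open>Bang (HIn a x a) P\<close> would have a transition whose bound name \<open>a\<close>
  captures the subject of the remaining replication.
\<close>

inductive step ::
  "(('f, 'v) expr \<Rightarrow> 'v \<Rightarrow> bool) \<Rightarrow> ('f, 'v) proc \<Rightarrow> 'v act \<Rightarrow> ('f, 'v) proc \<Rightarrow> bool"
  for ev where
  step_HIn: "b \<noteq> a \<Longrightarrow> step ev (Inp (HIn a x b) P) (AIn a v b) (subst x v P)"
| step_HOut: "ev e v \<Longrightarrow> b \<noteq> a \<Longrightarrow> step ev (Out a e b P) (AOut a v b) P"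
| step_FIn: "step ev (Inp (FIn h x) P) (AFIn h v) (subst x v P)"
| step_FOut: "ev e v \<Longrightarrow> step ev (FOut h e P) (AFOut h v) P"
| step_Succ: "step ev (Succ w P) (ASucc w) PNil"
| step_Bang: "step ev (Inp \<alpha> P) \<mu> Q \<Longrightarrow> step ev (Bang \<alpha> P) \<mu> (Par Q (Bang \<alpha> P))"
| step_NuH: "step ev P \<mu> P' \<Longrightarrow> n \<notin> hnames \<mu> \<Longrightarrow> step ev (NuH n P) \<mu> (NuH n P')"
| step_NuF: "step ev P \<mu> P' \<Longrightarrow> n \<notin> fnames \<mu> \<Longrightarrow> step ev (NuF n P) \<mu> (NuF n P')"
| step_SumL: "step ev P \<mu> P' \<Longrightarrow> step ev (PSum P Q) \<mu> P'"
| step_SumR: "step ev Q \<mu> Q' \<Longrightarrow> step ev (PSum P Q) \<mu> Q'"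
| step_ComHL: "step ev P (AIn a v b) P' \<Longrightarrow> step ev Q (AOut a v b) Q' \<Longrightarrow>
    step ev (Par P Q) Tau (NuH b (Par P' Q'))"
| step_ComHR: "step ev P (AOut a v b) P' \<Longrightarrow> step ev Q (AIn a v b) Q' \<Longrightarrow>
    step ev (Par P Q) Tau (NuH b (Par P' Q'))"
| step_ComFL: "step ev P (AFIn h v) P' \<Longrightarrow> step ev Q (AFOut h v) Q' \<Longrightarrow>
    step ev (Par P Q) Tau (Par P' Q')"
| step_ComFR: "step ev P (AFOut h v) P' \<Longrightarrow> step ev Q (AFIn h v) Q' \<Longrightarrow>
    step ev (Par P Q) Tau (Par P' Q')"
| step_ParL: "step ev P \<mu> P' \<Longrightarrow> bn \<mu> \<inter> fnh Q = {} \<Longrightarrow> step ev (Par P Q) \<mu> (Par P' Q)"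
| step_ParR: "step ev Q \<mu> Q' \<Longrightarrow> bn \<mu> \<inter> fnh P = {} \<Longrightarrow> step ev (Par P Q) \<mu> (Par P Q')"
| step_IfT: "ev e v \<Longrightarrow> ev f v \<Longrightarrow> step ev P \<mu> P' \<Longrightarrow> step ev (Cond e f P Q) \<mu> P'"
| step_IfF: "ev e v \<Longrightarrow> ev f w \<Longrightarrow> v \<noteq> w \<Longrightarrow> step ev Q \<mu> Q' \<Longrightarrow> step ev (Cond e f P Q) \<mu> Q'"


section \<open>Visibility functions and typing\<close>

datatype vdom = Cur | Nm hname

type_synonym vfun = "vdom \<Rightarrow> hname set option"

definition visibility :: "vfun \<Rightarrow> bool" where
  "visibility \<Delta> \<longleftrightarrow>
     finite (dom \<Delta>) \<and> (\<forall>V \<in> ran \<Delta>. finite V) \<and>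
     (\<forall>p a V W. \<Delta> p = Some V \<longrightarrow> \<Delta> (Nm a) = Some W \<longrightarrow> a \<in> V \<longrightarrow> W \<subseteq> V)"

definition vnames :: "vfun \<Rightarrow> hname set" where
  "vnames \<Delta> = {a. Nm a \<in> dom \<Delta>} \<union> \<Union> (ran \<Delta>)"

definition erase :: "vfun \<Rightarrow> vdom \<Rightarrow> vfun" where
  "erase \<Delta> p = (\<lambda>q. if q = p then None else map_option (\<lambda>V. {a \<in> V. Nm a \<noteq> p}) (\<Delta> q))"

definition vunion :: "vfun \<Rightarrow> vfun \<Rightarrow> vfun" where
  "vunion \<Delta>1 \<Delta>2 = (\<lambda>q. case \<Delta>1 q of
       None \<Rightarrow> \<Delta>2 q
     | Some V \<Rightarrow> (case \<Delta>2 q of None \<Rightarrow> Some V | Some W \<Rightarrow> Some (V \<union> W)))"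

definition vsplit :: "vfun \<Rightarrow> (vfun \<times> vfun) set" where
  "vsplit \<Delta> = {(\<Delta>1, \<Delta>2). visibility \<Delta>1 \<and> visibility \<Delta>2 \<and> vunion \<Delta>1 \<Delta>2 = \<Delta> \<and>
     Cur \<notin> dom \<Delta>1 \<inter> dom \<Delta>2}"

text \<open>
  Judgements range over visibility functions only, hence the premises \<open>visibility \<Delta>\<close>.
  As for any binder, the bound \<open>b\<close> in the two rules for higher-order prefixes is chosen (up to
  alpha-conversion) fresh for the whole of \<open>\<Delta>\<close>, not just for its domain.
\<close>

inductive typed :: "vfun \<Rightarrow> ('f, 'v) proc \<Rightarrow> bool" where
  typed_HOut: "visibility \<Delta> \<Longrightarrow> \<Delta> Cur = Some V \<Longrightarrow> a \<in> V \<Longrightarrow> b \<notin> vnames \<Delta> \<Longrightarrow>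
    typed ((erase \<Delta> Cur)(Nm b \<mapsto> V \<union> {b})) P \<Longrightarrow> typed \<Delta> (Out a e b P)"
| typed_HIn: "visibility \<Delta> \<Longrightarrow> Cur \<notin> dom \<Delta> \<Longrightarrow> \<Delta> (Nm a) = Some V \<Longrightarrow> b \<notin> vnames \<Delta> \<Longrightarrow>
    typed (\<Delta>(Cur \<mapsto> V \<union> {b})) P \<Longrightarrow> typed \<Delta> (Inp (HIn a x b) P)"
| typed_FOut: "visibility \<Delta> \<Longrightarrow> Cur \<notin> dom \<Delta> \<Longrightarrow> typed \<Delta> P \<Longrightarrow> typed \<Delta> (FOut h e P)"
| typed_FIn: "visibility \<Delta> \<Longrightarrow> Cur \<in> dom \<Delta> \<Longrightarrow> typed \<Delta> P \<Longrightarrow> typed \<Delta> (Inp (FIn h x) P)"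
| typed_Bang: "visibility \<Delta> \<Longrightarrow> Cur \<notin> dom \<Delta> \<Longrightarrow> typed \<Delta> (Inp \<alpha> P) \<Longrightarrow> typed \<Delta> (Bang \<alpha> P)"
| typed_Succ: "visibility \<Delta> \<Longrightarrow> typed \<Delta> (Succ w P)"
| typed_NuH: "visibility \<Delta> \<Longrightarrow> typed \<Delta> P \<Longrightarrow> typed (erase \<Delta> (Nm a)) (NuH a P)"
| typed_NuF: "visibility \<Delta> \<Longrightarrow> typed \<Delta> P \<Longrightarrow> typed \<Delta> (NuF h P)"
| typed_Nil: "visibility \<Delta> \<Longrightarrow> Cur \<notin> dom \<Delta> \<Longrightarrow> typed \<Delta> PNil"
| typed_Sum: "visibility \<Delta> \<Longrightarrow> typed \<Delta> P \<Longrightarrow> typed \<Delta> Q \<Longrightarrow> typed \<Delta> (PSum P Q)"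
| typed_Cond: "visibility \<Delta> \<Longrightarrow> typed \<Delta> P \<Longrightarrow> typed \<Delta> Q \<Longrightarrow> typed \<Delta> (Cond e f P Q)"
| typed_Par: "visibility \<Delta> \<Longrightarrow> (\<Delta>1, \<Delta>2) \<in> vsplit \<Delta> \<Longrightarrow> typed \<Delta>1 P \<Longrightarrow> typed \<Delta>2 Q \<Longrightarrow>
    typed \<Delta> (Par P Q)"

end

theory Submission
  imports Defs
begin

text \<open>
  Typing is first recast as a function of raw terms together with an interpretation \<open>\<rho>\<close> of their
  free names, a binder extending \<open>\<rho>\<close> by a fresh name. Alpha-conversion then only permutes the
  arguments of \<open>\<rho>\<close>, so that invariance is immediate and typing of processes can be inverted without
  analysing when two bound processes are equal. The typing is invariant under transpositions of the
  visibility function and, crucially, monotone: enlarging visibility (while keeping \<open>Cur\<close> in or out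
  of the domain) preserves it. By monotonicity, a split of \<open>\<Delta>\<close> may be taken to be \<open>\<Delta>\<close> itself on one
  side and \<open>\<Delta>\<close> without \<open>Cur\<close> on the other. In a communication on \<open>a\<close> the sender holds \<open>Cur\<close> with
  \<open>a \<in> \<Delta>(Cur)\<close>, whence \<open>\<Delta>(a) \<subseteq> \<Delta>(Cur)\<close> by transitivity, and monotonicity types the receiver with the
  visibility of the sender.
\<close>

subsection \<open>Visibility functions\<close>

lemma infinite_hname: "infinite (UNIV :: hname set)"
proof
  assume "finite (UNIV :: hname set)"
  then have "finite (range HName)" by (rule finite_subset[rotated]) simp
  then show False by (simp add: finite_image_iff inj_def)
qed

lemma ex_fresh_hname: "finite (A :: hname set) \<Longrightarrow> \<exists>c. c \<notin> A"
  using infinite_hname ex_new_if_finite by blast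

lemma finite_rfnh: "finite (rfnh P)"
  by (induction P) (auto split: inprefix.splits)

lemma finite_vnames: "visibility \<Delta> \<Longrightarrow> finite (vnames \<Delta>)"
proof -
  assume "visibility \<Delta>"
  then have "finite (dom \<Delta>)" "\<forall>V \<in> ran \<Delta>. finite V" by (auto simp: visibility_def)
  moreover have "{a. Nm a \<in> dom \<Delta>} = Nm -` dom \<Delta>" by auto
  ultimately show ?thesis
    by (auto simp: vnames_def finite_ran inj_def intro!: finite_vimageI)
qed

lemma notin_vnames:
  "c \<notin> vnames \<Delta> \<longleftrightarrow> \<Delta> (Nm c) = None \<and> (\<forall>p V. \<Delta> p = Some V \<longrightarrow> c \<notin> V)"
  by (auto simp: vnames_def ran_def)

lemma erase_Cur: "erase \<Delta> Cur = \<Delta>(Cur := None)"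
  by (rule ext) (simp add: erase_def option.map_ident_strong)

lemma visibility_iff:
  "visibility \<Delta> \<longleftrightarrow> finite (dom \<Delta>) \<and> (\<forall>p V. \<Delta> p = Some V \<longrightarrow> finite V) \<and>
     (\<forall>p a V W. \<Delta> p = Some V \<longrightarrow> \<Delta> (Nm a) = Some W \<longrightarrow> a \<in> V \<longrightarrow> W \<subseteq> V)"
  by (auto simp: visibility_def ran_def)

lemma visibility_trans:
  "visibility \<Delta> \<Longrightarrow> \<Delta> p = Some V \<Longrightarrow> \<Delta> (Nm a) = Some W \<Longrightarrow> a \<in> V \<Longrightarrow> x \<in> W \<Longrightarrow> x \<in> V"
  unfolding visibility_iff by blast

lemma visibility_finite: "visibility \<Delta> \<Longrightarrow> \<Delta> p = Some V \<Longrightarrow> finite V"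
  by (simp add: visibility_iff)

lemma visibility_erase: "visibility \<Delta> \<Longrightarrow> visibility (erase \<Delta> p)"
proof -
  assume v: "visibility \<Delta>"
  have "dom (erase \<Delta> p) \<subseteq> dom \<Delta>" by (auto simp: erase_def split: if_splits)
  then have "finite (dom (erase \<Delta> p))" using v by (auto simp: visibility_iff intro: finite_subset)
  then show ?thesis using v
    unfolding visibility_iff by (fastforce simp: erase_def split: if_splits)
qed

lemma visibility_no_Cur: "visibility \<Delta> \<Longrightarrow> visibility (\<Delta>(Cur := None))"
  using visibility_erase[of \<Delta> Cur] by (simp add: erase_Cur)

text \<open>As \<open>c\<close> occurs nowhere in \<open>\<Delta>\<close>, the new value is the only
  one to contain it, and there the condition on \<open>c\<close> is reflexive. For its other
  elements the new entry inherits transitivity from \<open>Cur\<close>.\<close>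

lemma visibility_output:
  assumes "visibility \<Delta>" "\<Delta> Cur = Some V" "c \<notin> vnames \<Delta>"
  shows "visibility (\<Delta>(Cur := None, Nm c \<mapsto> insert c V))"
  using assms visibility_finite[OF assms(1)]
  unfolding visibility_iff[of "\<Delta>(_ := _, _ \<mapsto> _)"] notin_vnames
  by (auto simp: visibility_def split: if_splits dest: visibility_trans[OF assms(1)])

lemma visibility_input:
  assumes "visibility \<Delta>" "\<Delta> (Nm a) = Some V" "c \<notin> vnames \<Delta>"
  shows "visibility (\<Delta>(Cur \<mapsto> insert c V))"
  using assms visibility_finite[OF assms(1)]
  unfolding visibility_iff[of "\<Delta>(_ \<mapsto> _)"] notin_vnames
  by (auto simp: visibility_def split: if_splits dest: visibility_trans[OF assms(1)])

text \<open>This is the visibility under the restriction that a communication creates: the receiver,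
  now at \<open>Cur\<close>, and the new name \<open>c\<close> both see what the sender saw,
  together with \<open>c\<close>.\<close>

lemma visibility_communication:
  assumes "visibility \<Delta>" "\<Delta> Cur = Some V" "c \<notin> vnames \<Delta>"
  shows "visibility (\<Delta>(Cur \<mapsto> insert c V, Nm c \<mapsto> insert c V))"
  using assms visibility_finite[OF assms(1)]
  unfolding visibility_iff[of "\<Delta>(_ \<mapsto> _, _ \<mapsto> _)"] notin_vnames
  by (auto simp: visibility_def split: if_splits dest: visibility_trans[OF assms(1)])

subsection \<open>Typing of raw terms\<close>

text \<open>
  Visibility of \<open>\<Delta>\<close> is left to the context, except under a restriction. A replicated first-order
  input is never typable, since it would need \<open>Cur\<close> both inside and outside the domain.
\<close>

primrec rtyped :: "('f, 'v) raw \<Rightarrow> (hname \<Rightarrow> hname) \<Rightarrow> vfun \<Rightarrow> bool" where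
  "rtyped RNil \<rho> \<Delta> \<longleftrightarrow> \<Delta> Cur = None"
| "rtyped (RInp \<alpha> P) \<rho> \<Delta> \<longleftrightarrow> (case \<alpha> of
      HIn a x b \<Rightarrow> \<Delta> Cur = None \<and> (\<exists>V c. \<Delta> (Nm (\<rho> a)) = Some V \<and>
        c \<notin> vnames \<Delta> \<and> c \<notin> \<rho> ` (rfnh P - {b}) \<and> rtyped P (\<rho>(b := c)) (\<Delta>(Cur \<mapsto> insert c V)))
    | FIn h x \<Rightarrow> \<Delta> Cur \<noteq> None \<and> rtyped P \<rho> \<Delta>)"
| "rtyped (ROut a e b P) \<rho> \<Delta> \<longleftrightarrow> (\<exists>V c. \<Delta> Cur = Some V \<and> \<rho> a \<in> V \<and>
      c \<notin> vnames \<Delta> \<and> c \<notin> \<rho> ` (rfnh P - {b}) \<and>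
      rtyped P (\<rho>(b := c)) (\<Delta>(Cur := None, Nm c \<mapsto> insert c V)))"
| "rtyped (RFOut h e P) \<rho> \<Delta> \<longleftrightarrow> \<Delta> Cur = None \<and> rtyped P \<rho> \<Delta>"
| "rtyped (RSucc w P) \<rho> \<Delta> \<longleftrightarrow> True"
| "rtyped (RBang \<alpha> P) \<rho> \<Delta> \<longleftrightarrow> (case \<alpha> of
      HIn a x b \<Rightarrow> \<Delta> Cur = None \<and> (\<exists>V c. \<Delta> (Nm (\<rho> a)) = Some V \<and>
        c \<notin> vnames \<Delta> \<and> c \<notin> \<rho> ` (rfnh P - {b}) \<and> rtyped P (\<rho>(b := c)) (\<Delta>(Cur \<mapsto> insert c V)))
    | FIn h x \<Rightarrow> False)"
| "rtyped (RPar P Q) \<rho> \<Delta> \<longleftrightarrow>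
      rtyped P \<rho> \<Delta> \<and> rtyped Q \<rho> (\<Delta>(Cur := None)) \<or> rtyped P \<rho> (\<Delta>(Cur := None)) \<and> rtyped Q \<rho> \<Delta>"
| "rtyped (RNuH a P) \<rho> \<Delta> \<longleftrightarrow> (\<exists>c \<Delta>0. c \<notin> \<rho> ` (rfnh P - {a}) \<and>
      visibility \<Delta>0 \<and> erase \<Delta>0 (Nm c) = \<Delta> \<and> rtyped P (\<rho>(a := c)) \<Delta>0)"
| "rtyped (RNuF h P) \<rho> \<Delta> \<longleftrightarrow> rtyped P \<rho> \<Delta>"
| "rtyped (RSum P Q) \<rho> \<Delta> \<longleftrightarrow> rtyped P \<rho> \<Delta> \<and> rtyped Q \<rho> \<Delta>"
| "rtyped (RIf e f P Q) \<rho> \<Delta> \<longleftrightarrow> rtyped P \<rho> \<Delta> \<and> rtyped Q \<rho> \<Delta>"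

text \<open>The clauses consult \<open>\<rho>\<close> at free names only. This absorbs the
  differences in \<open>\<rho>\<close> that renaming a binder leaves at names that are not
  free.\<close>

lemma rtyped_cong: "\<forall>a \<in> rfnh P. \<rho> a = \<rho>' a \<Longrightarrow> rtyped P \<rho> \<Delta> \<longleftrightarrow> rtyped P \<rho>' \<Delta>"
proof (induction P arbitrary: \<rho> \<rho>' \<Delta>)
  \<comment> \<open>At a binder of \<open>b\<close>, agreement off \<open>b\<close> becomes
    agreement on all of \<open>A\<close> after the update, and the freshness conditions see the same
    images.\<close>
  have upd: "\<forall>a \<in> A. (\<rho>(b := c)) a = (\<rho>'(b := c)) a" "\<rho> ` (A - {b}) = \<rho>' ` (A - {b})"
    if "\<forall>a \<in> A - {b}. \<rho> a = \<rho>' a" for A :: "hname set" and b c and \<rho> \<rho>' :: "hname \<Rightarrow> hname"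
    using that by (auto intro!: image_cong)
  {
    case (RInp \<alpha> P)
    show ?case
    proof (cases \<alpha>)
      case (HIn a x b)
      with RInp.prems have "\<rho> a = \<rho>' a" "\<forall>a \<in> rfnh P - {b}. \<rho> a = \<rho>' a" by auto
      with upd[OF this(2)] HIn RInp.IH[OF upd(1)[OF this(2)]] show ?thesis
        by (simp del: fun_upd_apply)
    next
      case (FIn h x)
      with RInp.prems RInp.IH[of \<rho> \<rho>'] show ?thesis by simp
    qed
  next
    case (RBang \<alpha> P)
    show ?case
    proof (cases \<alpha>)
      case (HIn a x b)
      with RBang.prems have "\<rho> a = \<rho>' a" "\<forall>a \<in> rfnh P - {b}. \<rho> a = \<rho>' a" by auto
      with upd[OF this(2)] HIn RBang.IH[OF upd(1)[OF this(2)]] show ?thesis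
        by (simp del: fun_upd_apply)
    qed simp
  next
    case (ROut a e b P)
    then have "\<rho> a = \<rho>' a" "\<forall>a \<in> rfnh P - {b}. \<rho> a = \<rho>' a" by auto
    with upd[OF this(2)] ROut.IH[OF upd(1)[OF this(2)]] show ?case by (simp del: fun_upd_apply)
  next
    case (RNuH b P)
    then have "\<forall>a \<in> rfnh P - {b}. \<rho> a = \<rho>' a" by auto
    with upd[OF this] RNuH.IH[OF upd(1)[OF this]] show ?case by (simp del: fun_upd_apply)
  next
    case (RFOut h e P)
    show ?case using RFOut.prems RFOut.IH[of \<rho> \<rho>'] by simp
  next
    case (RPar P Q)
    show ?case using RPar.prems RPar.IH(1)[of \<rho> \<rho>'] RPar.IH(2)[of \<rho> \<rho>'] by simp
  next
    case (RNuF h P)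
    show ?case using RNuF.prems RNuF.IH[of \<rho> \<rho>'] by simp
  next
    case (RSum P Q)
    show ?case using RSum.prems RSum.IH(1)[of \<rho> \<rho>'] RSum.IH(2)[of \<rho> \<rho>'] by simp
  next
    case (RIf e f P Q)
    show ?case using RIf.prems RIf.IH(1)[of \<rho> \<rho>'] RIf.IH(2)[of \<rho> \<rho>'] by simp
  }
qed simp_all

section \<open>Invariance of raw typing under alpha-conversion\<close>

lemma ren_binder:
  assumes "bij p"
  shows "\<rho>(p b := c) \<circ> p = (\<rho> \<circ> p)(b := c)"
    and "\<rho> ` (rfnh (ren p q r P) - {p b}) = (\<rho> \<circ> p) ` (rfnh P - {b})"
proof -
  have "inj p" using assms by (rule bij_is_inj)
  then show "\<rho>(p b := c) \<circ> p = (\<rho> \<circ> p)(b := c)" by (auto simp: fun_eq_iff inj_eq)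
  have "rfnh (ren p q r P) - {p b} = p ` (rfnh P - {b})"
    using \<open>inj p\<close> by (simp add: rfnh_ren image_set_diff)
  then show "\<rho> ` (rfnh (ren p q r P) - {p b}) = (\<rho> \<circ> p) ` (rfnh P - {b})"
    by (simp add: image_comp)
qed

text \<open>The interpretation \<open>c\<close> of a bound name is chosen independently of how that
  name is spelled, so the same witnesses serve on both sides and renaming merely precomposes
  \<open>\<rho>\<close>.\<close>

lemma rtyped_ren: "bij p \<Longrightarrow> rtyped (ren p q r P) \<rho> \<Delta> \<longleftrightarrow> rtyped P (\<rho> \<circ> p) \<Delta>"
proof (induction P arbitrary: \<rho> \<Delta>)
  case (RInp \<alpha> P)
  then show ?case
    by (cases \<alpha>; simp add: ren_binder del: fun_upd_apply o_apply; simp only: o_apply)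
next
  case (RBang \<alpha> P)
  then show ?case
    by (cases \<alpha>; simp add: ren_binder del: fun_upd_apply o_apply; simp only: o_apply)
qed (simp add: ren_binder del: fun_upd_apply o_apply; simp only: o_apply)+

text \<open>Precomposing \<open>\<rho>(c := d)\<close> with the transposition sends \<open>b\<close>
  to \<open>d\<close>; the result can differ from \<open>\<rho>(b := d)\<close> only at
  \<open>c\<close>, which is not free in \<open>P\<close>.\<close>

lemma rtyped_swap_binder:
  assumes "c \<notin> rfnh P"
  shows "rtyped (swap_h b c P) (\<rho>(c := d)) \<Delta> \<longleftrightarrow> rtyped P (\<rho>(b := d)) \<Delta>"
    and "\<rho> ` (rfnh (swap_h b c P) - {c}) = \<rho> ` (rfnh P - {b})"
proof -
  show "rtyped (swap_h b c P) (\<rho>(c := d)) \<Delta> \<longleftrightarrow> rtyped P (\<rho>(b := d)) \<Delta>"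
    unfolding rtyped_ren[OF bij_transpose] using assms
    by (intro rtyped_cong) (auto simp: transpose_def)
  show "\<rho> ` (rfnh (swap_h b c P) - {c}) = \<rho> ` (rfnh P - {b})"
    using assms by (simp add: rfnh_ren image_transpose_diff)
qed

text \<open>Congruence rules preserve the free names in the freshness conditions, renaming a bound
  higher-order name is absorbed by the interpretation, and renaming first-order names or variables
  acts on \<open>\<rho>\<close> as \<open>id\<close>.\<close>

lemma rtyped_aeq: "aeq P Q \<Longrightarrow> rtyped P \<rho> \<Delta> \<longleftrightarrow> rtyped Q \<rho> \<Delta>"
proof (induction arbitrary: \<rho> \<Delta> rule: aeq.induct)
  case (aeq_Inp P Q \<alpha>)
  then show ?case by (cases \<alpha>) (simp_all add: aeq_rfnh del: fun_upd_apply)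
next
  case (aeq_Bang P Q \<alpha>)
  then show ?case by (cases \<alpha>) (simp_all add: aeq_rfnh del: fun_upd_apply)
qed (simp_all add: aeq_rfnh rtyped_swap_binder rtyped_ren[of id] rfnh_ren[of id] del: fun_upd_apply)

subsection \<open>Equivariance\<close>

primrec vdom_map :: "(hname \<Rightarrow> hname) \<Rightarrow> vdom \<Rightarrow> vdom" where
  "vdom_map \<sigma> Cur = Cur"
| "vdom_map \<sigma> (Nm a) = Nm (\<sigma> a)"

text \<open>An action on partial functions precomposes with the inverse permutation;
  \<open>\<sigma>\<close> will always be an involution, so it appears itself in both places.\<close>

definition vact :: "(hname \<Rightarrow> hname) \<Rightarrow> vfun \<Rightarrow> vfun" where
  "vact \<sigma> \<Delta> = (\<lambda>p. map_option ((`) \<sigma>) (\<Delta> (vdom_map \<sigma> p)))"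

context
  fixes \<sigma> :: "hname \<Rightarrow> hname"
  assumes invol: "\<And>a. \<sigma> (\<sigma> a) = a"
begin

lemma inj_invol: "inj \<sigma>"
  by (metis injI invol)

lemma vdom_map_invol: "vdom_map \<sigma> (vdom_map \<sigma> p) = p"
  by (cases p) (simp_all add: invol)

lemma vact_Cur: "vact \<sigma> \<Delta> Cur = map_option ((`) \<sigma>) (\<Delta> Cur)"
  by (simp add: vact_def)

lemma vact_Nm: "vact \<sigma> \<Delta> (Nm (\<sigma> a)) = map_option ((`) \<sigma>) (\<Delta> (Nm a))"
  by (simp add: vact_def invol)

lemma vact_upd: "vact \<sigma> (\<Delta>(p := Vo)) = (vact \<sigma> \<Delta>)(vdom_map \<sigma> p := map_option ((`) \<sigma>) Vo)"
  by (auto simp: vact_def fun_eq_iff vdom_map_invol)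

lemma vact_SomeE:
  assumes "vact \<sigma> \<Delta> p = Some V"
  obtains q W where "p = vdom_map \<sigma> q" "V = \<sigma> ` W" "\<Delta> q = Some W"
proof -
  from assms obtain W where "\<Delta> (vdom_map \<sigma> p) = Some W" "V = \<sigma> ` W" by (auto simp: vact_def)
  then show ?thesis using that[of "vdom_map \<sigma> p"] by (simp add: vdom_map_invol)
qed

lemma notin_vnames_vact: "c \<notin> vnames \<Delta> \<Longrightarrow> \<sigma> c \<notin> vnames (vact \<sigma> \<Delta>)"
  unfolding notin_vnames by (auto simp: vact_Nm inj_eq[OF inj_invol] elim!: vact_SomeE)

lemma visibility_vact: "visibility \<Delta> \<Longrightarrow> visibility (vact \<sigma> \<Delta>)"
proof -
  assume v: "visibility \<Delta>"
  have "dom (vact \<sigma> \<Delta>) \<subseteq> vdom_map \<sigma> ` dom \<Delta>" by (auto elim!: vact_SomeE)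
  then have "finite (dom (vact \<sigma> \<Delta>))"
    using v by (auto simp: visibility_def elim: finite_subset[OF _ finite_imageI])
  moreover have "finite V" if "vact \<sigma> \<Delta> p = Some V" for p V
    using that visibility_finite[OF v] by (auto elim!: vact_SomeE)
  moreover have "W \<subseteq> V"
    if "vact \<sigma> \<Delta> p = Some V" "vact \<sigma> \<Delta> (Nm a) = Some W" "a \<in> V" for p a V W
  proof -
    from that obtain V' where V': "V = \<sigma> ` V'" "\<Delta> (vdom_map \<sigma> p) = Some V'" by (auto simp: vact_def)
    from that obtain W' where W': "W = \<sigma> ` W'" "\<Delta> (Nm (\<sigma> a)) = Some W'" by (auto simp: vact_def)
    have "\<sigma> a \<in> V'" using that V' by (auto simp: invol)
    then show ?thesis using visibility_trans[OF v V'(2) W'(2)] V' W' by auto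
  qed
  ultimately show ?thesis unfolding visibility_iff by blast
qed

lemma vact_erase: "vact \<sigma> (erase \<Delta> (Nm c)) = erase (vact \<sigma> \<Delta>) (Nm (\<sigma> c))"
proof
  fix p
  have "vdom_map \<sigma> p = Nm c \<longleftrightarrow> p = Nm (\<sigma> c)" by (cases p) (auto simp: invol)
  moreover have "\<sigma> ` {a \<in> V. a \<noteq> c} = {a \<in> \<sigma> ` V. a \<noteq> \<sigma> c}" for V by (auto simp: invol) (metis invol)+
  ultimately show "vact \<sigma> (erase \<Delta> (Nm c)) p = erase (vact \<sigma> \<Delta>) (Nm (\<sigma> c)) p"
    by (simp add: vact_def erase_def option.map_comp o_def)
qed

text \<open>Since \<open>\<sigma>\<close> is injective, the image of each fresh witness is fresh for
  the transported data.\<close>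

lemma rtyped_vact: "rtyped P \<rho> \<Delta> \<Longrightarrow> rtyped P (\<sigma> \<circ> \<rho>) (vact \<sigma> \<Delta>)"
proof (induction P arbitrary: \<rho> \<Delta>)
  have fresh: "\<sigma> c \<notin> (\<sigma> \<circ> \<rho>) ` A" if "c \<notin> \<rho> ` A" for c A and \<rho> :: "hname \<Rightarrow> hname"
    using that by (auto simp: inj_eq[OF inj_invol])
  \<comment> \<open>Serves both plain and replicated higher-order inputs, whose clauses
    coincide.\<close>
  have inp: "vact \<sigma> \<Delta> Cur = None \<and> (\<exists>V c. vact \<sigma> \<Delta> (Nm ((\<sigma> \<circ> \<rho>) a)) = Some V \<and>
        c \<notin> vnames (vact \<sigma> \<Delta>) \<and> c \<notin> (\<sigma> \<circ> \<rho>) ` (rfnh P - {b}) \<and>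
        rtyped P ((\<sigma> \<circ> \<rho>)(b := c)) ((vact \<sigma> \<Delta>)(Cur \<mapsto> insert c V)))"
    if "\<And>\<rho> \<Delta>. rtyped P \<rho> \<Delta> \<Longrightarrow> rtyped P (\<sigma> \<circ> \<rho>) (vact \<sigma> \<Delta>)"
      "\<Delta> Cur = None \<and> (\<exists>V c. \<Delta> (Nm (\<rho> a)) = Some V \<and>
        c \<notin> vnames \<Delta> \<and> c \<notin> \<rho> ` (rfnh P - {b}) \<and> rtyped P (\<rho>(b := c)) (\<Delta>(Cur \<mapsto> insert c V)))"
    for P :: "('a, 'b) raw" and \<rho> \<Delta> a b
  proof -
    from that(2) obtain V c where *: "\<Delta> Cur = None" "\<Delta> (Nm (\<rho> a)) = Some V"
      "c \<notin> vnames \<Delta>" "c \<notin> \<rho> ` (rfnh P - {b})" "rtyped P (\<rho>(b := c)) (\<Delta>(Cur \<mapsto> insert c V))"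
      by blast
    from that(1)[OF *(5)] have "rtyped P ((\<sigma> \<circ> \<rho>)(b := \<sigma> c)) ((vact \<sigma> \<Delta>)(Cur \<mapsto> insert (\<sigma> c) (\<sigma> ` V)))"
      by (simp add: fun_upd_comp vact_upd del: fun_upd_apply o_apply)
    with * fresh[OF *(4)] show ?thesis
      by (intro conjI exI[of _ "\<sigma> ` V"] exI[of _ "\<sigma> c"])
        (simp_all add: vact_Cur vact_Nm notin_vnames_vact )
  qed
  {
    case (RInp \<alpha> P)
    then show ?case
    proof (cases \<alpha>)
      case (HIn a x b)
      show ?thesis
        using RInp.prems unfolding HIn rtyped.simps inprefix.case by (rule inp[OF RInp.IH, rotated]) assumption
    next
      case (FIn h x)
      with RInp.prems RInp.IH show ?thesis by (simp add: vact_Cur)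
    qed
  next
    case (RBang \<alpha> P)
    then show ?case
    proof (cases \<alpha>)
      case (HIn a x b)
      show ?thesis
        using RBang.prems unfolding HIn rtyped.simps inprefix.case by (rule inp[OF RBang.IH, rotated]) assumption
    qed simp
  next
    case (ROut a e b P)
    then obtain V c where *: "\<Delta> Cur = Some V" "\<rho> a \<in> V" "c \<notin> vnames \<Delta>"
      "c \<notin> \<rho> ` (rfnh P - {b})" "rtyped P (\<rho>(b := c)) (\<Delta>(Cur := None, Nm c \<mapsto> insert c V))"
      by auto
    from ROut.IH[OF *(5)]
    have "rtyped P ((\<sigma> \<circ> \<rho>)(b := \<sigma> c)) ((vact \<sigma> \<Delta>)(Cur := None, Nm (\<sigma> c) \<mapsto> insert (\<sigma> c) (\<sigma> ` V)))"
      by (simp add: fun_upd_comp vact_upd del: fun_upd_apply o_apply)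
    with * fresh[OF *(4)] show ?case unfolding rtyped.simps
      by (intro exI[of _ "\<sigma> ` V"] exI[of _ "\<sigma> c"] conjI)
        (simp_all add: vact_Cur vact_Nm notin_vnames_vact )
  next
    case (RNuH b P)
    then obtain c \<Delta>0 where *: "c \<notin> \<rho> ` (rfnh P - {b})" "visibility \<Delta>0"
      "erase \<Delta>0 (Nm c) = \<Delta>" "rtyped P (\<rho>(b := c)) \<Delta>0"
      by auto
    from RNuH.IH[OF *(4)] have "rtyped P ((\<sigma> \<circ> \<rho>)(b := \<sigma> c)) (vact \<sigma> \<Delta>0)"
      by (simp add: fun_upd_comp del: fun_upd_apply o_apply)
    with * fresh[OF *(1)] show ?case unfolding rtyped.simps
      by (intro exI[of _ "\<sigma> c"] exI[of _ "vact \<sigma> \<Delta>0"] conjI)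
        (simp_all add: vact_erase[symmetric] visibility_vact )
  next
    case (RPar P Q)
    have eq: "(vact \<sigma> \<Delta>)(Cur := None) = vact \<sigma> (\<Delta>(Cur := None))" by (simp add: vact_upd)
    show ?case using RPar.prems unfolding rtyped.simps eq
      using RPar.IH[of \<rho> \<Delta>] RPar.IH[of \<rho> "\<Delta>(Cur := None)"] by argo
  }
qed (simp only: rtyped.simps vact_Cur option.map_disc_iff; blast)+

end

section \<open>Exchange of the fresh names chosen at binders\<close>

lemma transpose_fresh_image: "c \<notin> V \<Longrightarrow> c' \<notin> V \<Longrightarrow> transpose c c' ` V = V"
  by (auto simp: transpose_def image_iff)

lemma vact_transpose_fresh:
  assumes "c \<notin> vnames \<Delta>" "c' \<notin> vnames \<Delta>"
  shows "vact (transpose c c') \<Delta> = \<Delta>"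
proof
  fix p
  have "\<Delta> (vdom_map (transpose c c') p) = \<Delta> p"
    using assms by (cases p) (auto simp: notin_vnames transpose_def)
  then show "vact (transpose c c') \<Delta> p = \<Delta> p"
    using assms unfolding notin_vnames vact_def
    by (cases "\<Delta> p") (auto simp: transpose_fresh_image)
qed

text \<open>By equivariance: neither \<open>c\<close> nor \<open>c'\<close> interprets a free name
  other than \<open>b\<close>, so on free names the transposition affects only the value at
  \<open>b\<close>.\<close>

lemma rtyped_transpose_binder:
  assumes "rtyped P (\<rho>(b := c)) \<Delta>" "c \<notin> \<rho> ` (rfnh P - {b})" "c' \<notin> \<rho> ` (rfnh P - {b})"
  shows "rtyped P (\<rho>(b := c')) (vact (transpose c c') \<Delta>)"
proof -
  have "rtyped P (transpose c c' \<circ> \<rho>(b := c)) (vact (transpose c c') \<Delta>)"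
    using assms(1) by (rule rtyped_vact[rotated]) simp
  also have "rtyped P (transpose c c' \<circ> \<rho>(b := c)) (vact (transpose c c') \<Delta>) \<longleftrightarrow> ?thesis"
    using assms(2,3) by (intro rtyped_cong) (auto simp: transpose_def)
  finally show ?thesis .
qed

text \<open>Some fresh name is as good as any: the transposition fixes \<open>\<Delta>\<close> and
  \<open>V\<close>, as both names are absent from them. The existential in the clause thus acts as a
  universal.\<close>

lemma rtyped_input_any:
  assumes "rtyped P (\<rho>(b := c)) (\<Delta>(Cur \<mapsto> insert c V))" "\<Delta> (Nm a) = Some V"
    and "c \<notin> vnames \<Delta>" "c \<notin> \<rho> ` (rfnh P - {b})" "c' \<notin> vnames \<Delta>" "c' \<notin> \<rho> ` (rfnh P - {b})"
  shows "rtyped P (\<rho>(b := c')) (\<Delta>(Cur \<mapsto> insert c' V))"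
proof -
  have "transpose c c' ` V = V"
    using assms by (intro transpose_fresh_image) (auto simp: notin_vnames)
  then show ?thesis using rtyped_transpose_binder[OF assms(1,4,6)] assms(3,5)
    by (simp add: vact_upd vact_transpose_fresh)
qed

lemma rtyped_output_any:
  assumes "rtyped P (\<rho>(b := c)) (\<Delta>(Cur := None, Nm c \<mapsto> insert c V))" "\<Delta> Cur = Some V"
    and "c \<notin> vnames \<Delta>" "c \<notin> \<rho> ` (rfnh P - {b})" "c' \<notin> vnames \<Delta>" "c' \<notin> \<rho> ` (rfnh P - {b})"
  shows "rtyped P (\<rho>(b := c')) (\<Delta>(Cur := None, Nm c' \<mapsto> insert c' V))"
proof -
  have "transpose c c' ` V = V"
    using assms by (intro transpose_fresh_image) (auto simp: notin_vnames)
  then show ?thesis using rtyped_transpose_binder[OF assms(1,4,6)] assms(3,5)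
    by (simp add: vact_upd vact_transpose_fresh)
qed

subsection \<open>Weakening\<close>

text \<open>Presence of \<open>Cur\<close> must agree because typing tests it both ways:
  \<open>RNil\<close> demands its absence, a first-order input its presence.\<close>

definition vle :: "vfun \<Rightarrow> vfun \<Rightarrow> bool" where
  "vle \<Delta> \<Delta>' \<longleftrightarrow> (\<Delta> Cur = None \<longleftrightarrow> \<Delta>' Cur = None) \<and>
     (\<forall>p V. \<Delta> p = Some V \<longrightarrow> (\<exists>W. \<Delta>' p = Some W \<and> V \<subseteq> W))"

lemma vle_vnames: "vle \<Delta> \<Delta>' \<Longrightarrow> c \<notin> vnames \<Delta>' \<Longrightarrow> c \<notin> vnames \<Delta>"
  unfolding vle_def notin_vnames by (cases "\<Delta> (Nm c)") fastforce+

lemma vle_no_Cur: "vle \<Delta> \<Delta>' \<Longrightarrow> vle (\<Delta>(Cur := None)) (\<Delta>'(Cur := None))"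
  by (auto simp: vle_def)

lemma notin_vnames_erase: "c \<notin> vnames (erase \<Delta> (Nm c))"
  by (auto simp: notin_vnames erase_def split: if_splits)

text \<open>Weakening under a restriction: the enlarged function has to be exhibited as an erasure
  of some visibility function above \<open>\<Delta>0\<close>. The difficulty is to restore
  \<open>c\<close> without breaking transitivity.\<close>

lemma vle_unerase:
  assumes v0: "visibility \<Delta>0" and v': "visibility \<Delta>'"
    and le: "vle (erase \<Delta>0 (Nm c)) \<Delta>'" and c: "c \<notin> vnames \<Delta>'"
  shows "\<exists>\<Delta>1. visibility \<Delta>1 \<and> erase \<Delta>1 (Nm c) = \<Delta>' \<and> vle \<Delta>0 \<Delta>1"
proof -
  have c': "\<Delta>' (Nm c) = None" "\<And>p V. \<Delta>' p = Some V \<Longrightarrow> c \<notin> V" using c by (auto simp: notin_vnames)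
  have le': "\<exists>W. \<Delta>' p = Some W \<and> V - {c} \<subseteq> W" if "\<Delta>0 p = Some V" "p \<noteq> Nm c" for p V
  proof -
    from that have "erase \<Delta>0 (Nm c) p = Some (V - {c})" by (auto simp: erase_def)
    with le show ?thesis by (simp add: vle_def)
  qed
  have leCur: "\<Delta>0 Cur = None \<longleftrightarrow> \<Delta>' Cur = None" using le by (simp add: vle_def erase_def)
  show ?thesis
  proof (cases "\<Delta>0 (Nm c)")
    case None
    \<comment> \<open>With \<open>c\<close> outside the domain, transitivity imposes no condition on
      values containing \<open>c\<close>, so it may be added everywhere.\<close>
    define \<Delta>1 where "\<Delta>1 = (\<lambda>p. map_option (insert c) (\<Delta>' p))"
    have "dom \<Delta>1 = dom \<Delta>'" by (auto simp: \<Delta>1_def)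
    then have "visibility \<Delta>1"
      using v' visibility_finite[OF v'] c'
      unfolding visibility_iff[of \<Delta>1]
      by (auto simp: \<Delta>1_def visibility_def dest: visibility_trans[OF v'])
    moreover have "erase \<Delta>1 (Nm c) = \<Delta>'"
    proof
      fix p
      show "erase \<Delta>1 (Nm c) p = \<Delta>' p"
        using c' by (cases "\<Delta>' p") (auto simp: erase_def \<Delta>1_def)
    qed
    moreover have "vle \<Delta>0 \<Delta>1" unfolding vle_def
    proof (intro conjI allI impI)
      fix p V assume V: "\<Delta>0 p = Some V"
      then have "p \<noteq> Nm c" using None by auto
      from le'[OF V this] show "\<exists>W. \<Delta>1 p = Some W \<and> V \<subseteq> W" by (auto simp: \<Delta>1_def)
    qed (simp add: \<Delta>1_def leCur)
    ultimately show ?thesis by blast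
  next
    case (Some A)
    \<comment> \<open>What \<open>c\<close> must see besides itself: its old value, closed under the
      visibility of \<open>\<Delta>'\<close>.\<close>
    define B where "B = (A - {c}) \<union> \<Union> {W. \<exists>d \<in> A. \<Delta>' (Nm d) = Some W}"
    \<comment> \<open>\<open>c\<close> becomes visible from every point that transitivity permits\<close>
    define \<Delta>1 where "\<Delta>1 = (\<lambda>p. if p = Nm c then Some (insert c B)
       else map_option (\<lambda>V. if B \<subseteq> V then insert c V else V) (\<Delta>' p))"
    have cB: "c \<notin> B" using c' by (auto simp: B_def)
    have "finite {W. \<exists>d \<in> A. \<Delta>' (Nm d) = Some W}"
    proof (rule finite_subset)
      show "{W. \<exists>d \<in> A. \<Delta>' (Nm d) = Some W} \<subseteq> ran \<Delta>'" by (auto simp: ran_def)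
      show "finite (ran \<Delta>')" using v' by (simp add: visibility_def finite_ran)
    qed
    then have fB: "finite B"
      using visibility_finite[OF v0 Some] visibility_finite[OF v'] by (auto simp: B_def)
    \<comment> \<open>A single round of additions closes \<open>B\<close>, because
      \<open>\<Delta>'\<close> is itself transitive.\<close>
    have closed: "W \<subseteq> B" if "d \<in> B" "\<Delta>' (Nm d) = Some W" for d W
    proof -
      from that(1) consider "d \<in> A" | d' U where "d' \<in> A" "\<Delta>' (Nm d') = Some U" "d \<in> U"
        by (auto simp: B_def)
      then show ?thesis
      proof cases
        case 1
        then show ?thesis using that(2) by (auto simp: B_def)
      next
        case 2
        then show ?thesis using visibility_trans[OF v' 2(2) that(2) 2(3)] by (auto simp: B_def)
      qed
    qed
    have "dom \<Delta>1 \<subseteq> insert (Nm c) (dom \<Delta>')" by (auto simp: \<Delta>1_def split: if_splits)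
    then have "finite (dom \<Delta>1)" using v' by (auto simp: visibility_def elim: finite_subset)
    moreover have "finite V" if "\<Delta>1 p = Some V" for p V
      using that fB visibility_finite[OF v'] by (auto simp: \<Delta>1_def split: if_splits)
    moreover have "x \<in> V" if asm: "\<Delta>1 p = Some V" "\<Delta>1 (Nm a) = Some W" "a \<in> V" "x \<in> W" for p a V W x
    proof (cases "a = c")
      case True
      \<comment> \<open>A value of \<open>\<Delta>1\<close> contains \<open>c\<close> only if it
        belongs to \<open>c\<close> or was seen to include \<open>B\<close>.\<close>
      then show ?thesis using asm c' by (auto simp: \<Delta>1_def split: if_splits)
    next
      case False
      then obtain W' where W': "\<Delta>' (Nm a) = Some W'" "W = (if B \<subseteq> W' then insert c W' else W')"
        using asm by (auto simp: \<Delta>1_def)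
      show ?thesis
      proof (cases "p = Nm c")
        case True
        then have "a \<in> B" "V = insert c B" using asm False by (auto simp: \<Delta>1_def)
        then show ?thesis using closed W' asm(4) by (auto split: if_splits)
      next
        case nc: False
        then obtain V' where V': "\<Delta>' p = Some V'" "V = (if B \<subseteq> V' then insert c V' else V')"
          using asm by (auto simp: \<Delta>1_def)
        then have "a \<in> V'" using asm(3) False by (auto split: if_splits)
        then have "W' \<subseteq> V'" using visibility_trans[OF v' V'(1) W'(1)] by blast
        then show ?thesis using W' V' asm(4) by (auto split: if_splits)
      qed
    qed
    ultimately have "visibility \<Delta>1" unfolding visibility_iff by blast
    moreover have "erase \<Delta>1 (Nm c) = \<Delta>'"
    proof
      fix p
      show "erase \<Delta>1 (Nm c) p = \<Delta>' p"
        using c' by (cases "\<Delta>' p") (auto simp: erase_def \<Delta>1_def)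
    qed
    moreover have "\<exists>W. \<Delta>1 p = Some W \<and> V \<subseteq> W" if "\<Delta>0 p = Some V" for p V
    proof (cases "p = Nm c")
      case True
      then show ?thesis using that Some by (auto simp: \<Delta>1_def B_def)
    next
      case False
      from le'[OF that False] obtain W where W: "\<Delta>' p = Some W" "V - {c} \<subseteq> W" by blast
      \<comment> \<open>Transitivity of \<open>\<Delta>0\<close> at \<open>c\<close> puts
        \<open>A\<close> inside \<open>V\<close>, and transitivity of \<open>\<Delta>'\<close> then
        puts all of \<open>B\<close> inside \<open>W\<close>; hence \<open>c\<close> was indeed
        inserted at \<open>p\<close>.\<close>
      have "B \<subseteq> W" if "c \<in> V"
      proof -
        have "A - {c} \<subseteq> W" using visibility_trans[OF v0 \<open>\<Delta>0 p = Some V\<close> Some that] W by blast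
        moreover have "U \<subseteq> W" if "d \<in> A" "\<Delta>' (Nm d) = Some U" for d U
        proof -
          have "d \<in> W" using that c'(1) \<open>A - {c} \<subseteq> W\<close> by (cases "d = c") auto
          then show ?thesis using visibility_trans[OF v' W(1) that(2)] by blast
        qed
        ultimately show ?thesis unfolding B_def by blast
      qed
      then show ?thesis using W False by (auto simp: \<Delta>1_def)
    qed
    ultimately show ?thesis using leCur by (auto simp: vle_def \<Delta>1_def)
  qed
qed

text \<open>Each binder first moves to a name fresh for the larger function; then the extended
  functions are again comparable. Restriction relies on \<open>vle_unerase\<close>.\<close>

lemma rtyped_weaken: "rtyped P \<rho> \<Delta> \<Longrightarrow> vle \<Delta> \<Delta>' \<Longrightarrow> visibility \<Delta>' \<Longrightarrow> rtyped P \<rho> \<Delta>'"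
proof (induction P arbitrary: \<rho> \<Delta> \<Delta>')
  have fresh: "\<exists>c. c \<notin> vnames \<Delta> \<and> c \<notin> \<rho> ` (rfnh P - {b})"
    if "visibility \<Delta>" for \<rho> :: "hname \<Rightarrow> hname" and P :: "('a, 'b) raw" and b \<Delta>
    using ex_fresh_hname[of "vnames \<Delta> \<union> \<rho> ` (rfnh P - {b})"] that
    by (simp add: finite_vnames finite_rfnh)
  have inp: "\<Delta>' Cur = None \<and> (\<exists>V c. \<Delta>' (Nm (\<rho> a)) = Some V \<and>
        c \<notin> vnames \<Delta>' \<and> c \<notin> \<rho> ` (rfnh P - {b}) \<and> rtyped P (\<rho>(b := c)) (\<Delta>'(Cur \<mapsto> insert c V)))"
    if IH: "\<And>\<rho> \<Delta> \<Delta>'. rtyped P \<rho> \<Delta> \<Longrightarrow> vle \<Delta> \<Delta>' \<Longrightarrow> visibility \<Delta>' \<Longrightarrow> rtyped P \<rho> \<Delta>'"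
      and prem: "\<Delta> Cur = None \<and> (\<exists>V c. \<Delta> (Nm (\<rho> a)) = Some V \<and>
        c \<notin> vnames \<Delta> \<and> c \<notin> \<rho> ` (rfnh P - {b}) \<and> rtyped P (\<rho>(b := c)) (\<Delta>(Cur \<mapsto> insert c V)))"
      and le: "vle \<Delta> \<Delta>'" and v: "visibility \<Delta>'"
    for P :: "('a, 'b) raw" and \<rho> \<Delta> \<Delta>' a b
  proof -
    from prem obtain V c where *: "\<Delta> Cur = None" "\<Delta> (Nm (\<rho> a)) = Some V"
      "c \<notin> vnames \<Delta>" "c \<notin> \<rho> ` (rfnh P - {b})" "rtyped P (\<rho>(b := c)) (\<Delta>(Cur \<mapsto> insert c V))"
      by blast
    from le * obtain W where W: "\<Delta>' Cur = None" "\<Delta>' (Nm (\<rho> a)) = Some W" "V \<subseteq> W"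
      unfolding vle_def by blast
    \<comment> \<open>The witness \<open>c\<close> may occur in \<open>\<Delta>'\<close>; a name
      fresh for \<open>\<Delta>'\<close> is fresh for both functions.\<close>
    obtain d where d: "d \<notin> vnames \<Delta>'" "d \<notin> \<rho> ` (rfnh P - {b})" using fresh[OF v] by blast
    have "rtyped P (\<rho>(b := d)) (\<Delta>(Cur \<mapsto> insert d V))"
      using rtyped_input_any[OF *(5,2-4)] vle_vnames[OF le] d by blast
    moreover have "vle (\<Delta>(Cur \<mapsto> insert d V)) (\<Delta>'(Cur \<mapsto> insert d W))"
      using le W by (auto simp: vle_def)
    ultimately have "rtyped P (\<rho>(b := d)) (\<Delta>'(Cur \<mapsto> insert d W))"
      using visibility_input[OF v W(2) d(1)] by (rule IH)
    with d W show ?thesis by blast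
  qed
  {
    case (RInp \<alpha> P)
    then show ?case
    proof (cases \<alpha>)
      case (HIn a x b)
      show ?thesis
        using RInp.prems unfolding HIn rtyped.simps inprefix.case by (rule inp[OF RInp.IH, rotated 3])
    next
      case (FIn h x)
      with RInp.prems RInp.IH[OF _ RInp.prems(2,3)] show ?thesis
        by (simp add: vle_def del: not_None_eq)
    qed
  next
    case (RBang \<alpha> P)
    then show ?case
    proof (cases \<alpha>)
      case (HIn a x b)
      show ?thesis
        using RBang.prems unfolding HIn rtyped.simps inprefix.case by (rule inp[OF RBang.IH, rotated 3])
    qed simp
  next
    case (ROut a e b P)
    from ROut.prems(1) obtain V c where *: "\<Delta> Cur = Some V" "\<rho> a \<in> V" "c \<notin> vnames \<Delta>"
      "c \<notin> \<rho> ` (rfnh P - {b})" "rtyped P (\<rho>(b := c)) (\<Delta>(Cur := None, Nm c \<mapsto> insert c V))"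
      by auto
    from ROut.prems * obtain W where W: "\<Delta>' Cur = Some W" "V \<subseteq> W" unfolding vle_def by blast
    obtain d where d: "d \<notin> vnames \<Delta>'" "d \<notin> \<rho> ` (rfnh P - {b})" using fresh[OF ROut.prems(3)] by blast
    have "rtyped P (\<rho>(b := d)) (\<Delta>(Cur := None, Nm d \<mapsto> insert d V))"
      using rtyped_output_any[OF *(5,1,3,4)] vle_vnames[OF ROut.prems(2)] d by blast
    moreover have "vle (\<Delta>(Cur := None, Nm d \<mapsto> insert d V)) (\<Delta>'(Cur := None, Nm d \<mapsto> insert d W))"
      using ROut.prems(2) W by (auto simp: vle_def)
    ultimately have "rtyped P (\<rho>(b := d)) (\<Delta>'(Cur := None, Nm d \<mapsto> insert d W))"
      using visibility_output[OF ROut.prems(3) W(1) d(1)] by (rule ROut.IH)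
    with d W * show ?case unfolding rtyped.simps by blast
  next
    case (RNuH b P)
    from RNuH.prems(1) obtain c \<Delta>0 where *: "c \<notin> \<rho> ` (rfnh P - {b})" "visibility \<Delta>0"
      "erase \<Delta>0 (Nm c) = \<Delta>" "rtyped P (\<rho>(b := c)) \<Delta>0"
      by auto
    obtain d where d: "d \<notin> vnames \<Delta>'" "d \<notin> \<rho> ` (rfnh P - {b})" using fresh[OF RNuH.prems(3)] by blast
    \<comment> \<open>Moves the erased name from \<open>c\<close> to \<open>d\<close>. The erasure
      remains \<open>\<Delta>\<close>, where neither name occurs.\<close>
    let ?\<Delta> = "vact (transpose c d) \<Delta>0"
    have "erase ?\<Delta> (Nm d) = vact (transpose c d) \<Delta>"
      using vact_erase[of "transpose c d" \<Delta>0 c] *(3) by simp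
    also have "\<dots> = \<Delta>"
      using vact_transpose_fresh notin_vnames_erase[of c \<Delta>0] *(3) vle_vnames[OF RNuH.prems(2) d(1)] by blast
    finally have "vle (erase ?\<Delta> (Nm d)) \<Delta>'" using RNuH.prems(2) by simp
    moreover have "visibility ?\<Delta>" using *(2) by (simp add: visibility_vact)
    ultimately obtain \<Delta>1 where \<Delta>1: "visibility \<Delta>1" "erase \<Delta>1 (Nm d) = \<Delta>'" "vle ?\<Delta> \<Delta>1"
      using vle_unerase RNuH.prems(3) d(1) by blast
    have "rtyped P (\<rho>(b := d)) ?\<Delta>" using rtyped_transpose_binder[OF *(4,1) d(2)] .
    then have "rtyped P (\<rho>(b := d)) \<Delta>1" using \<Delta>1(3,1) by (rule RNuH.IH)
    with \<Delta>1 d show ?case unfolding rtyped.simps by blast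
  next
    case (RPar P Q)
    note IHs = RPar.IH[OF _ RPar.prems(2,3)]
      RPar.IH[OF _ vle_no_Cur[OF RPar.prems(2)] visibility_no_Cur[OF RPar.prems(3)]]
    show ?case using RPar.prems(1) unfolding rtyped.simps by (blast intro: IHs)
  next
    case (RFOut h e P)
    show ?case using RFOut.prems RFOut.IH[OF _ RFOut.prems(2,3)] by (simp add: vle_def)
  next
    case RNil
    then show ?case by (auto simp: vle_def)
  next
    case (RNuF h P)
    show ?case using RNuF.prems(1) RNuF.IH[OF _ RNuF.prems(2,3)] by simp
  next
    case (RSum P Q)
    show ?case using RSum.prems(1) RSum.IH[OF _ RSum.prems(2,3)] by simp
  next
    case (RIf e f P Q)
    show ?case using RIf.prems(1) RIf.IH[OF _ RIf.prems(2,3)] by simp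
  }
qed simp_all

subsection \<open>Typing of processes\<close>

lemma ren_expr_id: "ren_expr id e = e"
  by (induction e) (auto simp: map_idI)

lemma ren_pre_id: "ren_pre id id id \<alpha> = \<alpha>"
  by (cases \<alpha>) auto

lemma ren_id: "ren id id id P = P"
  by (induction P) (simp_all add: ren_expr_id ren_pre_id del: id_apply, simp_all)

text \<open>Successive swaps collapse into one permutation, so the induction in
  \<open>typed_if_rtyped\<close> can carry a single \<open>p\<close>.\<close>

lemma swap_h_ren: "swap_h b c (ren p id id P) = ren (transpose b c \<circ> p) id id P"
proof (induction P)
  case (RInp \<alpha> P)
  then show ?case by (cases \<alpha>) simp_all
next
  case (RBang \<alpha> P)
  then show ?case by (cases \<alpha>) simp_all
qed (simp_all add: ren_expr_id del: id_apply, simp_all)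

section \<open>Raw typing lifted to processes, with its inversion equations\<close>

lift_definition ptyped :: "('f, 'v) proc \<Rightarrow> (hname \<Rightarrow> hname) \<Rightarrow> vfun \<Rightarrow> bool" is rtyped
  using rtyped_aeq by blast

lemma ptyped_Nil:
  "ptyped PNil \<rho> \<Delta> \<longleftrightarrow> \<Delta> Cur = None"
  by transfer (simp only: rtyped.simps inprefix.case)

lemma ptyped_HIn:
  "ptyped (Inp (HIn a x b) P) \<rho> \<Delta> \<longleftrightarrow> \<Delta> Cur = None \<and> (\<exists>V c. \<Delta> (Nm (\<rho> a)) = Some V \<and>
      c \<notin> vnames \<Delta> \<and> c \<notin> \<rho> ` (fnh P - {b}) \<and> ptyped P (\<rho>(b := c)) (\<Delta>(Cur \<mapsto> insert c V)))"
  by transfer (simp only: rtyped.simps inprefix.case)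

lemma ptyped_FIn:
  "ptyped (Inp (FIn h x) P) \<rho> \<Delta> \<longleftrightarrow> \<Delta> Cur \<noteq> None \<and> ptyped P \<rho> \<Delta>"
  by transfer (simp only: rtyped.simps inprefix.case)

lemma ptyped_Out:
  "ptyped (Out a e b P) \<rho> \<Delta> \<longleftrightarrow> (\<exists>V c. \<Delta> Cur = Some V \<and> \<rho> a \<in> V \<and>
      c \<notin> vnames \<Delta> \<and> c \<notin> \<rho> ` (fnh P - {b}) \<and>
      ptyped P (\<rho>(b := c)) (\<Delta>(Cur := None, Nm c \<mapsto> insert c V)))"
  by transfer (simp only: rtyped.simps inprefix.case)

lemma ptyped_FOut:
  "ptyped (FOut h e P) \<rho> \<Delta> \<longleftrightarrow> \<Delta> Cur = None \<and> ptyped P \<rho> \<Delta>"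
  by transfer (simp only: rtyped.simps inprefix.case)

lemma ptyped_Succ:
  "ptyped (Succ w P) \<rho> \<Delta> \<longleftrightarrow> True"
  by transfer (simp only: rtyped.simps inprefix.case)

lemma ptyped_Bang:
  "ptyped (Bang \<alpha> P) \<rho> \<Delta> \<longleftrightarrow> \<Delta> Cur = None \<and> ptyped (Inp \<alpha> P) \<rho> \<Delta>"
  by transfer (auto split: inprefix.split)

lemma ptyped_Par:
  "ptyped (Par P Q) \<rho> \<Delta> \<longleftrightarrow>
      ptyped P \<rho> \<Delta> \<and> ptyped Q \<rho> (\<Delta>(Cur := None)) \<or> ptyped P \<rho> (\<Delta>(Cur := None)) \<and> ptyped Q \<rho> \<Delta>"
  by transfer (simp only: rtyped.simps inprefix.case)

lemma ptyped_NuH: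
  "ptyped (NuH a P) \<rho> \<Delta> \<longleftrightarrow> (\<exists>c \<Delta>0. c \<notin> \<rho> ` (fnh P - {a}) \<and>
      visibility \<Delta>0 \<and> erase \<Delta>0 (Nm c) = \<Delta> \<and> ptyped P (\<rho>(a := c)) \<Delta>0)"
  by transfer (simp only: rtyped.simps inprefix.case)

lemma ptyped_NuF:
  "ptyped (NuF k P) \<rho> \<Delta> \<longleftrightarrow> ptyped P \<rho> \<Delta>"
  by transfer (simp only: rtyped.simps inprefix.case)

lemma ptyped_Sum:
  "ptyped (PSum P Q) \<rho> \<Delta> \<longleftrightarrow> ptyped P \<rho> \<Delta> \<and> ptyped Q \<rho> \<Delta>"
  by transfer (simp only: rtyped.simps inprefix.case)

lemma ptyped_Cond:
  "ptyped (Cond e f P Q) \<rho> \<Delta> \<longleftrightarrow> ptyped P \<rho> \<Delta> \<and> ptyped Q \<rho> \<Delta>"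
  by transfer (simp only: rtyped.simps inprefix.case)

lemmas ptyped_simps =
  ptyped_Nil ptyped_HIn ptyped_FIn ptyped_Out ptyped_FOut ptyped_Succ ptyped_Bang ptyped_Par ptyped_NuH ptyped_NuF ptyped_Sum ptyped_Cond

lemma fnh_simps:
  "fnh PNil = {}"
  "fnh (Inp (HIn a x b) P) = insert a (fnh P - {b})"
  "fnh (Inp (FIn h x) P) = fnh P"
  "fnh (Out a e b P) = insert a (fnh P - {b})"
  "fnh (FOut h e P) = fnh P"
  "fnh (Succ w P) = fnh P"
  "fnh (Bang \<alpha> P) = fnh (Inp \<alpha> P)"
  "fnh (Par P Q) = fnh P \<union> fnh Q"
  "fnh (NuH a P) = fnh P - {a}"
  "fnh (NuF k P) = fnh P"
  "fnh (PSum P Q) = fnh P \<union> fnh Q"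
  "fnh (Cond e f P Q) = fnh P \<union> fnh Q"
  by (transfer, simp split: inprefix.split)+

lemma finite_fnh: "finite (fnh P)"
  by transfer (rule finite_rfnh)

lemma fnh_subst: "fnh (subst x v P) = fnh P"
  by transfer (rule rfnh_rsubst)

text \<open>Typing reads only the shape of a term and its higher-order names, both of which value
  substitution preserves.\<close>

lemma ptyped_subst:
  fixes P :: "('f, 'v) proc"
  shows "ptyped (subst x v P) \<rho> \<Delta> \<longleftrightarrow> ptyped P \<rho> \<Delta>"
proof (transfer fixing: x v \<rho> \<Delta>)
  fix P :: "('f, 'v) raw"
  show "rtyped (rsubst x v P) \<rho> \<Delta> \<longleftrightarrow> rtyped P \<rho> \<Delta>"
  proof (induction P arbitrary: \<rho> \<Delta>)
    case (RInp \<alpha> P)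
    then show ?case by (cases \<alpha>) (simp_all add: rfnh_rsubst del: fun_upd_apply)
  next
    case (RBang \<alpha> P)
    then show ?case by (cases \<alpha>) (simp_all add: rfnh_rsubst del: fun_upd_apply)
  qed (simp_all add: rfnh_rsubst del: fun_upd_apply)
qed

lemma ptyped_cong: "\<forall>a \<in> fnh P. \<rho> a = \<rho>' a \<Longrightarrow> ptyped P \<rho> \<Delta> \<longleftrightarrow> ptyped P \<rho>' \<Delta>"
  by (transfer fixing: \<rho> \<rho>' \<Delta>) (rule rtyped_cong)

lemma ptyped_weaken: "ptyped P \<rho> \<Delta> \<Longrightarrow> vle \<Delta> \<Delta>' \<Longrightarrow> visibility \<Delta>' \<Longrightarrow> ptyped P \<rho> \<Delta>'"
  by (transfer fixing: \<rho> \<Delta> \<Delta>') (rule rtyped_weaken)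

lemma ptyped_input_any:
  assumes "ptyped P (\<rho>(b := c)) (\<Delta>(Cur \<mapsto> insert c V))" "\<Delta> (Nm a) = Some V"
    and "c \<notin> vnames \<Delta>" "c \<notin> \<rho> ` (fnh P - {b})" "c' \<notin> vnames \<Delta>" "c' \<notin> \<rho> ` (fnh P - {b})"
  shows "ptyped P (\<rho>(b := c')) (\<Delta>(Cur \<mapsto> insert c' V))"
  using assms by (transfer fixing: \<rho> \<Delta> b c c' V) (rule rtyped_input_any)

lemma ptyped_output_any:
  assumes "ptyped P (\<rho>(b := c)) (\<Delta>(Cur := None, Nm c \<mapsto> insert c V))" "\<Delta> Cur = Some V"
    and "c \<notin> vnames \<Delta>" "c \<notin> \<rho> ` (fnh P - {b})" "c' \<notin> vnames \<Delta>" "c' \<notin> \<rho> ` (fnh P - {b})"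
  shows "ptyped P (\<rho>(b := c')) (\<Delta>(Cur := None, Nm c' \<mapsto> insert c' V))"
  using assms by (transfer fixing: \<rho> \<Delta> b c c' V) (rule rtyped_output_any)

section \<open>Agreement of the inductive typing with the interpreted one\<close>

lemma visibility_typed: "typed \<Delta> P \<Longrightarrow> visibility \<Delta>"
  by (induction rule: typed.induct) (auto intro: visibility_erase)

text \<open>At most one component holds \<open>Cur\<close>; it lies below \<open>\<Delta>\<close>,
  and the other lies below \<open>\<Delta>\<close> stripped of \<open>Cur\<close>.\<close>

lemma vle_vsplit:
  assumes "(\<Delta>1, \<Delta>2) \<in> vsplit \<Delta>"
  shows "vle \<Delta>1 \<Delta> \<and> vle \<Delta>2 (\<Delta>(Cur := None)) \<or> vle \<Delta>1 (\<Delta>(Cur := None)) \<and> vle \<Delta>2 \<Delta>"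
proof -
  have \<Delta>: "\<Delta> = vunion \<Delta>1 \<Delta>2" and Cur: "\<Delta>1 Cur = None \<or> \<Delta>2 Cur = None"
    using assms by (auto simp: vsplit_def)
  have "\<exists>W. \<Delta> p = Some W \<and> V \<subseteq> W" if "\<Delta>1 p = Some V \<or> \<Delta>2 p = Some V" for p V
    using that by (auto simp: \<Delta> vunion_def split: option.splits)
  moreover have "\<Delta> Cur = None \<longleftrightarrow> \<Delta>1 Cur = None \<and> \<Delta>2 Cur = None"
    by (auto simp: \<Delta> vunion_def split: option.splits)
  ultimately show ?thesis using Cur by (auto simp: vle_def)
qed

lemma id_upd: "id(a := a) = id"
  by auto

text \<open>Under the identity interpretation each bound name is its own witness. For a parallel
  composition, weakening replaces an arbitrary split by the canonical one.\<close>

lemma ptyped_if_typed: "typed \<Delta> P \<Longrightarrow> ptyped P id \<Delta>"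
proof (induction rule: typed.induct)
  case (typed_HOut \<Delta> V a b P e)
  then have "ptyped P (id(b := b)) (\<Delta>(Cur := None, Nm b \<mapsto> insert b V))"
    by (simp add: erase_Cur id_upd del: fun_upd_apply id_apply)
  with typed_HOut show ?case unfolding ptyped_simps by auto
next
  case (typed_HIn \<Delta> a V b P x)
  then have "ptyped P (id(b := b)) (\<Delta>(Cur \<mapsto> insert b V))"
    by (simp add: id_upd del: fun_upd_apply id_apply)
  with typed_HIn show ?case unfolding ptyped_simps by auto
next
  case (typed_NuH \<Delta> P a)
  then have "ptyped P (id(a := a)) \<Delta>" by (simp add: id_upd del: fun_upd_apply id_apply)
  with typed_NuH show ?case unfolding ptyped_simps by auto
next
  case (typed_Par \<Delta> \<Delta>1 \<Delta>2 P Q)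
  then show ?case using vle_vsplit[OF typed_Par.hyps(2)] visibility_no_Cur[OF typed_Par.hyps(1)]
    unfolding ptyped_simps by (blast intro: ptyped_weaken)
qed (auto simp: ptyped_simps)

lemma vsplit_no_Cur:
  assumes "visibility \<Delta>"
  shows "(\<Delta>, \<Delta>(Cur := None)) \<in> vsplit \<Delta>" "(\<Delta>(Cur := None), \<Delta>) \<in> vsplit \<Delta>"
  using assms visibility_no_Cur[OF assms]
  by (auto simp: vsplit_def vunion_def fun_eq_iff split: option.split)

text \<open>A binder must be alpha-converted to bind its witness \<open>c\<close>, and the swapped
  body is no longer a subterm. It is still a renaming of the same subterm, hence the induction over
  \<open>ren p id id P\<close> with \<open>p\<close> arbitrary.\<close>

lemma typed_if_rtyped:
  "bij p \<Longrightarrow> visibility \<Delta> \<Longrightarrow> rtyped (ren p id id P) id \<Delta> \<Longrightarrow> typed \<Delta> (abs_proc (ren p id id P))"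
proof (induction P arbitrary: p \<Delta>)
  \<comment> \<open>After the swap, the bound name is literally \<open>c\<close>, so the identity
    interprets the body again.\<close>
  have bind: "rtyped (ren (transpose (p b) c \<circ> p) id id P) id \<Delta>"
    if "rtyped (ren p id id P) (id(p b := c)) \<Delta>" "c \<notin> id ` (rfnh (ren p id id P) - {p b})"
    for p b c \<Delta> and P :: "('a, 'b) raw"
  proof -
    have "rtyped (ren p id id P) (transpose (p b) c) \<Delta>"
      using that by (subst rtyped_cong[where \<rho>' = "id(p b := c)"]) (auto simp: transpose_def)
    then show ?thesis
      using rtyped_ren[of "transpose (p b) c" id id "ren p id id P" id \<Delta>] by (simp add: swap_h_ren)
  qed
  have bij: "bij (transpose b c \<circ> p)" if "bij p" for b c and p :: "hname \<Rightarrow> hname"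
    using that by (simp add: bij_comp)
  have inp: "typed \<Delta> (Inp (HIn (p a) x (p b)) (abs_proc (ren p id id P)))"
    if IH: "\<And>p \<Delta>. bij p \<Longrightarrow> visibility \<Delta> \<Longrightarrow> rtyped (ren p id id P) id \<Delta> \<Longrightarrow>
        typed \<Delta> (abs_proc (ren p id id P))"
      and p: "bij p" and v: "visibility \<Delta>"
      and t: "rtyped (RInp (HIn (p a) x (p b)) (ren p id id P)) id \<Delta>"
    for p \<Delta> a x b and P :: "('a, 'b) raw"
  proof -
    let ?P = "ren p id id P"
    from t obtain V c where *: "\<Delta> Cur = None" "\<Delta> (Nm (p a)) = Some V" "c \<notin> vnames \<Delta>"
      "c \<notin> id ` (rfnh ?P - {p b})" "rtyped ?P (id(p b := c)) (\<Delta>(Cur \<mapsto> insert c V))"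
      by auto
    \<comment> \<open>If \<open>c\<close> is already the bound name the swap is the identity;
      otherwise \<open>c\<close> is not free in the body and alpha-conversion applies.\<close>
    have "aeq (RInp (HIn (p a) x (p b)) ?P) (RInp (HIn (p a) x c) (swap_h (p b) c ?P))"
      using *(4) by (cases "c = p b") (auto simp: aeq_refl ren_id intro: aeq_ren_InpH)
    then have "Inp (HIn (p a) x (p b)) (abs_proc ?P) = Inp (HIn (p a) x c) (abs_proc (swap_h (p b) c ?P))"
      by (simp add: Inp.abs_eq proc.abs_eq_iff)
    moreover have "typed (\<Delta>(Cur \<mapsto> insert c V)) (abs_proc (swap_h (p b) c ?P))"
      unfolding swap_h_ren
      by (rule IH[OF bij[OF p] visibility_input[OF v *(2,3)] bind[OF *(5,4)]])
    ultimately show ?thesis using * v by (simp add: typed_HIn domIff)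
  qed
  {
    case RNil
    then show ?case using typed_Nil by (simp add: PNil.abs_eq[symmetric] domIff)
  next
    case (RInp \<alpha> P)
    show ?case
    proof (cases \<alpha>)
      case (HIn a x b)
      then have "rtyped (RInp (HIn (p a) x (p b)) (ren p id id P)) id \<Delta>"
        using RInp.prems(3) by (simp only: ren.simps ren_pre.simps id_def)
      then have "typed \<Delta> (Inp (HIn (p a) x (p b)) (abs_proc (ren p id id P)))"
        by (intro inp[OF RInp.IH RInp.prems(1,2)])
      then show ?thesis by (simp only: HIn ren.simps ren_pre.simps id_def Inp.abs_eq)
    next
      case (FIn h x)
      with RInp.prems RInp.IH[OF RInp.prems(1,2)] show ?thesis
        by (auto simp: Inp.abs_eq[symmetric] intro: typed_FIn)
    qed
  next
    case (ROut a e b P)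
    let ?P = "ren p id id P"
    from ROut.prems(3)[unfolded ren.simps rtyped.simps] obtain V c where
      *: "\<Delta> Cur = Some V" "id (p a) \<in> V" "c \<notin> vnames \<Delta>"
      "c \<notin> id ` (rfnh ?P - {p b})" "rtyped ?P (id(p b := c)) (\<Delta>(Cur := None, Nm c \<mapsto> insert c V))"
      by blast
    have "aeq (ROut (p a) e (p b) ?P) (ROut (p a) e c (swap_h (p b) c ?P))"
      using *(4) by (cases "c = p b") (auto simp: aeq_refl ren_id intro: aeq_ren_Out)
    then have "abs_proc (ROut (p a) e (p b) ?P) = Out (p a) e c (abs_proc (swap_h (p b) c ?P))"
      by (simp add: Out.abs_eq proc.abs_eq_iff)
    moreover have "typed (\<Delta>(Cur := None, Nm c \<mapsto> insert c V)) (abs_proc (swap_h (p b) c ?P))"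
      unfolding swap_h_ren
      by (rule ROut.IH[OF bij[OF ROut.prems(1)] visibility_output[OF ROut.prems(2) *(1,3)]
            bind[OF *(5,4)]])
    then have "typed \<Delta> (Out (p a) e c (abs_proc (swap_h (p b) c ?P)))"
      using *(1-3) ROut.prems(2) by (intro typed_HOut[where V = V]) (simp_all add: erase_Cur)
    ultimately show ?case by (simp only: ren.simps ren_expr_id)
  next
    case (RFOut h e P)
    show ?case using RFOut.prems RFOut.IH[OF RFOut.prems(1,2)]
      by (auto simp: FOut.abs_eq[symmetric] intro: typed_FOut)
  next
    case (RSucc w P)
    then show ?case by (simp add: Succ.abs_eq[symmetric] typed_Succ)
  next
    case (RBang \<alpha> P)
    show ?case
    proof (cases \<alpha>)
      case (HIn a x b)
      with RBang.prems(3) have "\<Delta> Cur = None"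
        "rtyped (RInp (HIn (p a) x (p b)) (ren p id id P)) id \<Delta>"
        by (simp_all only: ren.simps ren_pre.simps rtyped.simps inprefix.case id_def)
      then have "typed \<Delta> (Inp (HIn (p a) x (p b)) (abs_proc (ren p id id P)))"
        by (intro inp[OF RBang.IH RBang.prems(1,2)])
      then have "typed \<Delta> (Bang (HIn (p a) x (p b)) (abs_proc (ren p id id P)))"
        using RBang.prems(2) \<open>\<Delta> Cur = None\<close> by (intro typed_Bang) auto
      then show ?thesis by (simp only: HIn ren.simps ren_pre.simps id_def Bang.abs_eq)
    next
      case (FIn h x)
      with RBang.prems show ?thesis by simp
    qed
  next
    case (RPar P Q)
    note v = RPar.prems(2) visibility_no_Cur[OF RPar.prems(2)]
    from RPar.prems(3) show ?case
      using RPar.IH[OF RPar.prems(1) v(1)] RPar.IH[OF RPar.prems(1) v(2)] vsplit_no_Cur[OF v(1)]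
      by (simp add: Par.abs_eq[symmetric] del: fun_upd_apply) (blast intro: typed_Par v(1))
  next
    case (RNuH b P)
    let ?P = "ren p id id P"
    from RNuH.prems(3)[unfolded ren.simps rtyped.simps] obtain c \<Delta>0 where
      *: "c \<notin> id ` (rfnh ?P - {p b})" "visibility \<Delta>0"
      "erase \<Delta>0 (Nm c) = \<Delta>" "rtyped ?P (id(p b := c)) \<Delta>0"
      by blast
    have "aeq (RNuH (p b) ?P) (RNuH c (swap_h (p b) c ?P))"
      using *(1) by (cases "c = p b") (auto simp: aeq_refl ren_id intro: aeq_ren_NuH)
    then have "abs_proc (RNuH (p b) ?P) = NuH c (abs_proc (swap_h (p b) c ?P))"
      by (simp add: NuH.abs_eq proc.abs_eq_iff)
    moreover have "typed \<Delta>0 (abs_proc (swap_h (p b) c ?P))"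
      unfolding swap_h_ren by (rule RNuH.IH[OF bij[OF RNuH.prems(1)] *(2) bind[OF *(4,1)]])
    then have "typed \<Delta> (NuH c (abs_proc (swap_h (p b) c ?P)))"
      using typed_NuH[OF *(2)] *(3) by blast
    ultimately show ?case by (simp only: ren.simps)
  next
    case (RNuF h P)
    show ?case using RNuF.prems RNuF.IH[OF RNuF.prems(1,2)]
      by (auto simp: NuF.abs_eq[symmetric] intro: typed_NuF)
  next
    case (RSum P Q)
    show ?case using RSum.prems RSum.IH[OF RSum.prems(1,2)]
      by (auto simp: PSum.abs_eq[symmetric] intro: typed_Sum)
  next
    case (RIf e f P Q)
    show ?case using RIf.prems RIf.IH[OF RIf.prems(1,2)]
      by (auto simp: Cond.abs_eq[symmetric] intro: typed_Cond)
  }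
qed

lemma typed_iff_ptyped: "typed \<Delta> P \<longleftrightarrow> visibility \<Delta> \<and> ptyped P id \<Delta>"
proof
  assume "visibility \<Delta> \<and> ptyped P id \<Delta>"
  moreover obtain R where "P = abs_proc R"
    by (rule that[of "rep_proc P"]) (simp add: Quotient3_abs_rep[OF Quotient3_proc])
  ultimately show "typed \<Delta> P"
    using typed_if_rtyped[of id \<Delta> R] by (simp add: ren_id ptyped.abs_eq del: id_apply)
qed (simp add: visibility_typed ptyped_if_typed)

subsection \<open>Subject reduction\<close>

text \<open>Inversion with the fresh name chosen off a further finite set, such as the names of a
  parallel component or an erased name.\<close>

lemma ptyped_InpE:
  assumes "ptyped (Inp (HIn a x b) P) \<rho> \<Delta>" "visibility \<Delta>" "finite X"
  obtains V c where "\<Delta> Cur = None" "\<Delta> (Nm (\<rho> a)) = Some V" "c \<notin> X" "c \<notin> vnames \<Delta>"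
    "c \<notin> \<rho> ` (fnh P - {b})" "ptyped P (\<rho>(b := c)) (\<Delta>(Cur \<mapsto> insert c V))"
proof -
  from assms(1) obtain V d where *: "\<Delta> Cur = None" "\<Delta> (Nm (\<rho> a)) = Some V" "d \<notin> vnames \<Delta>"
    "d \<notin> \<rho> ` (fnh P - {b})" "ptyped P (\<rho>(b := d)) (\<Delta>(Cur \<mapsto> insert d V))"
    unfolding ptyped_HIn by blast
  obtain c where "c \<notin> X \<union> vnames \<Delta> \<union> \<rho> ` (fnh P - {b})"
    using ex_fresh_hname[of "X \<union> vnames \<Delta> \<union> \<rho> ` (fnh P - {b})"] assms(2,3)
    by (auto simp: finite_vnames finite_fnh)
  then show ?thesis using that[OF *(1,2)] ptyped_input_any[OF *(5,2-4)] by blast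
qed

lemma ptyped_OutE:
  assumes "ptyped (Out a e b P) \<rho> \<Delta>" "visibility \<Delta>" "finite X"
  obtains V c where "\<Delta> Cur = Some V" "\<rho> a \<in> V" "c \<notin> X" "c \<notin> vnames \<Delta>"
    "c \<notin> \<rho> ` (fnh P - {b})" "ptyped P (\<rho>(b := c)) (\<Delta>(Cur := None, Nm c \<mapsto> insert c V))"
proof -
  from assms(1) obtain V d where *: "\<Delta> Cur = Some V" "\<rho> a \<in> V" "d \<notin> vnames \<Delta>"
    "d \<notin> \<rho> ` (fnh P - {b})" "ptyped P (\<rho>(b := d)) (\<Delta>(Cur := None, Nm d \<mapsto> insert d V))"
    unfolding ptyped_Out by blast
  obtain c where "c \<notin> X \<union> vnames \<Delta> \<union> \<rho> ` (fnh P - {b})"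
    using ex_fresh_hname[of "X \<union> vnames \<Delta> \<union> \<rho> ` (fnh P - {b})"] assms(2,3)
    by (auto simp: finite_vnames finite_fnh)
  then show ?thesis using that[OF *(1,2)] ptyped_output_any[OF *(5,1,3,4)] by blast
qed

section \<open>Free and bound names along transitions\<close>

text \<open>A restricted name cannot be the subject of an action crossing its restriction. This
  later keeps the interpreted subject apart from the erased name.\<close>

lemma step_subject_free: "step ev P \<mu> P' \<Longrightarrow> \<mu> = AIn a v b \<or> \<mu> = AOut a v b \<Longrightarrow> a \<in> fnh P"
  by (induction rule: step.induct) (auto simp: fnh_simps)

lemma step_fnh: "step ev P \<mu> P' \<Longrightarrow> fnh P' \<subseteq> fnh P \<union> bn \<mu>"
  by (induction rule: step.induct) (auto simp: fnh_simps fnh_subst)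

text \<open>A head test stable under alpha-conversion: it discards the impossible cases when a
  transition of an input is inverted, the process constructors being quotiented.\<close>

lift_definition is_input :: "('f, 'v) proc \<Rightarrow> bool" is "\<lambda>P. \<exists>\<alpha> Q. P = RInp \<alpha> Q"
  by (erule aeq.induct) auto

lemma is_input_simps:
  "is_input (Inp \<alpha> P)" "\<not> is_input (Out a e b P)" "\<not> is_input (FOut h e P)" "\<not> is_input (Succ w P)"
  "\<not> is_input (Bang \<alpha> P)" "\<not> is_input (Par P Q)" "\<not> is_input (NuH a P)" "\<not> is_input (NuF h P)"
  "\<not> is_input (PSum P Q)" "\<not> is_input (Cond e f P Q)"
  by (transfer, simp)+

text \<open>The bound name differs from the subject by the side condition of \<open>step_HIn\<close>
  and is bound in the body. Hence the copy left behind by a replication is not captured.\<close>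

lemma step_input_bn: "step ev (Inp \<alpha> P) \<mu> Q \<Longrightarrow> bn \<mu> \<inter> fnh (Inp \<alpha> P) = {}"
proof -
  have "bn \<mu> \<inter> fnh R = {}" if "step ev R \<mu> Q" "is_input R" for R
    using that by cases (auto simp: is_input_simps fnh_simps)
  then show "step ev (Inp \<alpha> P) \<mu> Q \<Longrightarrow> ?thesis" by (simp add: is_input_simps)
qed

text \<open>
  A bound output or input is recorded by putting the corresponding prefix back in front of the
  derivative; this quantifies over all fresh choices of the bound name at once. The value sent and
  the variable in that prefix play no role.
\<close>

primrec derivative_typed ::
  "'v act \<Rightarrow> ('f, 'v) proc \<Rightarrow> (hname \<Rightarrow> hname) \<Rightarrow> vfun \<Rightarrow> bool" where
  "derivative_typed Tau P \<rho> \<Delta> \<longleftrightarrow> ptyped P \<rho> \<Delta>"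
| "derivative_typed (AIn a v b) P \<rho> \<Delta> \<longleftrightarrow>
    (\<Delta> Cur = None \<longrightarrow> ptyped (Inp (HIn a (FVar 0) b) P) \<rho> \<Delta>)"
| "derivative_typed (AOut a v b) P \<rho> \<Delta> \<longleftrightarrow> ptyped (Out a (Val v) b P) \<rho> \<Delta>"
| "derivative_typed (AFIn h v) P \<rho> \<Delta> \<longleftrightarrow> \<Delta> Cur \<noteq> None \<and> ptyped P \<rho> \<Delta>"
| "derivative_typed (AFOut h v) P \<rho> \<Delta> \<longleftrightarrow> (\<Delta> Cur = None \<longrightarrow> ptyped P \<rho> \<Delta>)"
| "derivative_typed (ASucc w) P \<rho> \<Delta> \<longleftrightarrow> True"

section \<open>Preservation under parallel composition, communication and restriction\<close>

lemma ptyped_Par_commute: "ptyped (Par P Q) \<rho> \<Delta> \<longleftrightarrow> ptyped (Par Q P) \<rho> \<Delta>"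
  by (auto simp: ptyped_simps)

lemma derivative_typed_Par_commute:
  "derivative_typed \<mu> (Par P Q) \<rho> \<Delta> \<longleftrightarrow> derivative_typed \<mu> (Par Q P) \<rho> \<Delta>"
  by (cases \<mu>) (auto simp: ptyped_Par_commute[of P Q] ptyped_HIn ptyped_Out fnh_simps Un_commute)

lemma derivative_typed_ParL:
  assumes P': "\<And>\<Delta>. ptyped P \<rho> \<Delta> \<Longrightarrow> visibility \<Delta> \<Longrightarrow> derivative_typed \<mu> P' \<rho> \<Delta>"
    and PQ: "ptyped (Par P Q) \<rho> \<Delta>" and v: "visibility \<Delta>" and fresh: "bn \<mu> \<inter> fnh Q = {}"
  shows "derivative_typed \<mu> (Par P' Q) \<rho> \<Delta>"
proof -
  note v0 = visibility_no_Cur[OF v]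
  \<comment> \<open>The idle component does not contain the bound name, so reinterpreting that name
    leaves its typing unchanged.\<close>
  have Q_upd: "ptyped Q (\<rho>(b := c)) \<Delta>' \<longleftrightarrow> ptyped Q \<rho> \<Delta>'" if "bn \<mu> = {b}" for b c \<Delta>'
    using that fresh by (intro ptyped_cong) auto
  have split: "derivative_typed \<mu> P' \<rho> \<Delta> \<and> ptyped Q \<rho> (\<Delta>(Cur := None)) \<or>
      derivative_typed \<mu> P' \<rho> (\<Delta>(Cur := None)) \<and> ptyped Q \<rho> \<Delta>"
    using PQ P'[OF _ v] P'[OF _ v0] unfolding ptyped_Par by blast
  show ?thesis
  proof (cases \<mu>)
    case (AIn a w b)
    show ?thesis unfolding AIn derivative_typed.simps
    proof
      assume Cur: "\<Delta> Cur = None"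
      then have none: "\<Delta>(Cur := None) = \<Delta>" by auto
      from split have "ptyped (Inp (HIn a (FVar 0) b) P') \<rho> \<Delta>" and Q: "ptyped Q \<rho> \<Delta>"
        using Cur by (auto simp: AIn none)
      from this(1) v obtain V c where *: "\<Delta> (Nm (\<rho> a)) = Some V" "c \<notin> \<rho> ` fnh Q" "c \<notin> vnames \<Delta>"
        "c \<notin> \<rho> ` (fnh P' - {b})" "ptyped P' (\<rho>(b := c)) (\<Delta>(Cur \<mapsto> insert c V))"
        by (elim ptyped_InpE[where X = "\<rho> ` fnh Q"]) (auto simp: finite_fnh)
      have "ptyped (Par P' Q) (\<rho>(b := c)) (\<Delta>(Cur \<mapsto> insert c V))"
        unfolding ptyped_Par using *(5) Q by (simp add: none Q_upd AIn del: fun_upd_apply)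
      with * Cur show "ptyped (Inp (HIn a (FVar 0) b) (Par P' Q)) \<rho> \<Delta>"
        unfolding ptyped_HIn fnh_simps by blast
    qed
  next
    case (AOut a w b)
    \<comment> \<open>An output requires \<open>Cur\<close>, so the acting component holds
      it.\<close>
    have "\<not> ptyped (Out a (Val w) b P') \<rho> (\<Delta>(Cur := None))" by (simp add: ptyped_Out)
    with split have "ptyped (Out a (Val w) b P') \<rho> \<Delta>" and Q: "ptyped Q \<rho> (\<Delta>(Cur := None))"
      by (simp_all add: AOut)
    from this(1) v obtain V c where *: "\<Delta> Cur = Some V" "\<rho> a \<in> V" "c \<notin> \<rho> ` fnh Q" "c \<notin> vnames \<Delta>"
      "c \<notin> \<rho> ` (fnh P' - {b})" "ptyped P' (\<rho>(b := c)) (\<Delta>(Cur := None, Nm c \<mapsto> insert c V))"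
      by (elim ptyped_OutE[where X = "\<rho> ` fnh Q"]) (auto simp: finite_fnh)
    \<comment> \<open>The output adds an entry for \<open>c\<close>, which the idle component must
      tolerate; weakening provides this.\<close>
    have "vle (\<Delta>(Cur := None)) (\<Delta>(Cur := None, Nm c \<mapsto> insert c V))"
      using *(4) by (auto simp: vle_def notin_vnames)
    then have "ptyped Q \<rho> (\<Delta>(Cur := None, Nm c \<mapsto> insert c V))"
      using Q visibility_output[OF v *(1,4)] ptyped_weaken by blast
    moreover have "\<Delta>(Cur := None, Nm c \<mapsto> insert c V, Cur := None) = \<Delta>(Cur := None, Nm c \<mapsto> insert c V)"
      by auto
    ultimately have "ptyped (Par P' Q) (\<rho>(b := c)) (\<Delta>(Cur := None, Nm c \<mapsto> insert c V))"
      unfolding ptyped_Par using *(6) by (simp add: Q_upd AOut del: fun_upd_apply)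
    with * show ?thesis unfolding AOut derivative_typed.simps ptyped_Out fnh_simps by blast
  qed (use split in \<open>auto simp: ptyped_Par fun_upd_idem\<close>)
qed

lemma ptyped_communication:
  assumes v: "visibility \<Delta>" and PQ: "ptyped (Par P Q) \<rho> \<Delta>"
    and P': "\<And>\<Delta>. ptyped P \<rho> \<Delta> \<Longrightarrow> visibility \<Delta> \<Longrightarrow> derivative_typed (AIn a u b) P' \<rho> \<Delta>"
    and Q': "\<And>\<Delta>. ptyped Q \<rho> \<Delta> \<Longrightarrow> visibility \<Delta> \<Longrightarrow> derivative_typed (AOut a u b) Q' \<rho> \<Delta>"
  shows "ptyped (NuH b (Par P' Q')) \<rho> \<Delta>"
proof -
  note v0 = visibility_no_Cur[OF v]
  \<comment> \<open>The sender must hold \<open>Cur\<close>, which leaves the receiver in the part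
    without it.\<close>
  have "\<not> ptyped Q \<rho> (\<Delta>(Cur := None))" using Q'[OF _ v0] by (auto simp: ptyped_Out)
  with PQ have "ptyped P \<rho> (\<Delta>(Cur := None))" "ptyped Q \<rho> \<Delta>" by (auto simp: ptyped_Par)
  with P'[OF _ v0] Q'[OF _ v] have p: "ptyped (Inp (HIn a (FVar 0) b) P') \<rho> (\<Delta>(Cur := None))"
    and q: "ptyped (Out a (Val u) b Q') \<rho> \<Delta>" by simp_all
  from q v obtain V where V: "\<Delta> Cur = Some V" "\<rho> a \<in> V"
    by (elim ptyped_OutE[where X = "{}"]) auto
  \<comment> \<open>The name is taken fresh for both derivatives, so that a single \<open>c\<close>
    interprets \<open>b\<close> on both sides.\<close>
  from p v0 obtain W c where W: "\<Delta> (Nm (\<rho> a)) = Some W" "c \<notin> vnames \<Delta> \<union> \<rho> ` (fnh Q' - {b})"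
    "c \<notin> \<rho> ` (fnh P' - {b})" "ptyped P' (\<rho>(b := c)) (\<Delta>(Cur \<mapsto> insert c W))"
    by (elim ptyped_InpE[where X = "vnames \<Delta> \<union> \<rho> ` (fnh Q' - {b})"])
      (auto simp: finite_fnh finite_vnames[OF v])
  \<comment> \<open>\<open>Cur\<close> passes from sender to receiver: the receiver's derivative is
    typed under this function, the sender's under the same without \<open>Cur\<close>, and erasing
    \<open>c\<close> returns \<open>\<Delta>\<close>.\<close>
  let ?\<Delta> = "\<Delta>(Cur \<mapsto> insert c V, Nm c \<mapsto> insert c V)"
  have c: "c \<notin> vnames \<Delta>" using W(2) by simp
  have vis: "visibility ?\<Delta>" using visibility_communication[OF v V(1) c] .
  have "W \<subseteq> V" using visibility_trans[OF v V(1) W(1) V(2)] by blast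
  then have "vle (\<Delta>(Cur \<mapsto> insert c W)) ?\<Delta>" using c by (auto simp: vle_def notin_vnames)
  then have "ptyped P' (\<rho>(b := c)) ?\<Delta>" using W(4) vis ptyped_weaken by blast
  moreover have "ptyped Q' (\<rho>(b := c)) (?\<Delta>(Cur := None))"
  proof -
    \<comment> \<open>The sender's own witness \<open>d\<close> is exchanged for the receiver's
      \<open>c\<close>.\<close>
    from q obtain V' d where "\<Delta> Cur = Some V'" "d \<notin> vnames \<Delta>" "d \<notin> \<rho> ` (fnh Q' - {b})"
      "ptyped Q' (\<rho>(b := d)) (\<Delta>(Cur := None, Nm d \<mapsto> insert d V'))"
      unfolding ptyped_Out by blast
    then have "ptyped Q' (\<rho>(b := c)) (\<Delta>(Cur := None, Nm c \<mapsto> insert c V))"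
      using ptyped_output_any[of Q' \<rho> b d \<Delta> V' c] V(1) c W(2) by auto
    moreover have "?\<Delta>(Cur := None) = \<Delta>(Cur := None, Nm c \<mapsto> insert c V)" by auto
    ultimately show ?thesis by simp
  qed
  ultimately have "ptyped (Par P' Q') (\<rho>(b := c)) ?\<Delta>" unfolding ptyped_Par by blast
  moreover have "erase ?\<Delta> (Nm c) = \<Delta>"
  proof
    fix p
    show "erase ?\<Delta> (Nm c) p = \<Delta> p"
      using c V(1) by (cases "\<Delta> p") (auto simp: erase_def notin_vnames)
  qed
  moreover have "c \<notin> \<rho> ` (fnh (Par P' Q') - {b})" using W(2,3) by (auto simp: fnh_simps)
  ultimately show ?thesis using vis unfolding ptyped_NuH by blast
qed

text \<open>A first-order input takes place where \<open>Cur\<close> is, so the sender is in the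
  part without \<open>Cur\<close>, exactly where a first-order output preserves typing.\<close>

lemma ptyped_first_order_communication:
  assumes v: "visibility \<Delta>" and PQ: "ptyped (Par P Q) \<rho> \<Delta>"
    and P': "\<And>\<Delta>. ptyped P \<rho> \<Delta> \<Longrightarrow> visibility \<Delta> \<Longrightarrow> derivative_typed (AFIn h u) P' \<rho> \<Delta>"
    and Q': "\<And>\<Delta>. ptyped Q \<rho> \<Delta> \<Longrightarrow> visibility \<Delta> \<Longrightarrow> derivative_typed (AFOut h u) Q' \<rho> \<Delta>"
  shows "ptyped (Par P' Q') \<rho> \<Delta>"
  using PQ P'[OF _ v] P'[OF _ visibility_no_Cur[OF v]] Q'[OF _ visibility_no_Cur[OF v]]
  unfolding ptyped_Par by auto

text \<open>The restricted name and the action's bound name receive distinct interpretations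
  \<open>c\<close> and \<open>d\<close>; erasing the one then commutes with extending by the
  other.\<close>

lemma derivative_typed_NuH:
  assumes P': "\<And>\<rho> \<Delta>. ptyped P \<rho> \<Delta> \<Longrightarrow> visibility \<Delta> \<Longrightarrow> derivative_typed \<mu> P' \<rho> \<Delta>"
    and P: "ptyped (NuH n P) \<rho> \<Delta>" and n: "n \<notin> hnames \<mu>"
    and subj: "\<And>a v b. \<mu> = AIn a v b \<or> \<mu> = AOut a v b \<Longrightarrow> a \<in> fnh P"
    and fn: "fnh P' \<subseteq> fnh P \<union> bn \<mu>"
  shows "derivative_typed \<mu> (NuH n P') \<rho> \<Delta>"
proof -
  from P obtain c \<Delta>0 where c: "c \<notin> \<rho> ` (fnh P - {n})" and v: "visibility \<Delta>0"
    and \<Delta>: "erase \<Delta>0 (Nm c) = \<Delta>" and "ptyped P (\<rho>(n := c)) \<Delta>0"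
    unfolding ptyped_NuH by blast
  then have D: "derivative_typed \<mu> P' (\<rho>(n := c)) \<Delta>0" using P' by blast
  have Cur: "\<Delta> Cur = map_option (\<lambda>V. V - {c}) (\<Delta>0 Cur)"
    by (cases "\<Delta>0 Cur") (auto simp: \<Delta>[symmetric] erase_def)
  have vn: "d \<notin> vnames \<Delta>" if "d \<notin> vnames \<Delta>0" for d
    using that by (auto simp: \<Delta>[symmetric] erase_def notin_vnames split: if_splits)
  \<comment> \<open>A free name of \<open>P'\<close> other than \<open>n\<close> is either free in
    \<open>P\<close>, where \<open>c\<close> is fresh, or the bound name, now interpreted by
    \<open>d\<close>.\<close>
  have cb: "c \<notin> (\<rho>(b := d)) ` (fnh P' - {n})" if "bn \<mu> = {b}" "d \<noteq> c" for b d
    using that fn c by auto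
  have plain: "ptyped (NuH n P') \<rho> \<Delta>" if "ptyped P' (\<rho>(n := c)) \<Delta>0" "bn \<mu> = {}"
    using that c v \<Delta> fn unfolding ptyped_NuH by blast
  show ?thesis
  proof (cases \<mu>)
    case (AIn a u b)
    then have nab: "n \<noteq> a" "n \<noteq> b" using n by auto
    \<comment> \<open>The subject is free in the restricted process, so erasing \<open>c\<close>
      keeps its entry in the domain.\<close>
    have "\<rho> a \<noteq> c" using subj AIn c nab by blast
    show ?thesis unfolding AIn derivative_typed.simps
    proof
      assume none: "\<Delta> Cur = None"
      then have "ptyped (Inp (HIn a (FVar 0) b) P') (\<rho>(n := c)) \<Delta>0" using D Cur by (simp add: AIn)
      then obtain W d where *: "\<Delta>0 (Nm ((\<rho>(n := c)) a)) = Some W" "d \<notin> {c}" "d \<notin> vnames \<Delta>0"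
        "d \<notin> (\<rho>(n := c)) ` (fnh P' - {b})" "ptyped P' (\<rho>(n := c, b := d)) (\<Delta>0(Cur \<mapsto> insert d W))"
        using v by (elim ptyped_InpE[where X = "{c}"]) auto
      have cbd: "c \<notin> (\<rho>(b := d)) ` (fnh P' - {n})" using cb[of b d] *(2) AIn by simp
      have W: "\<Delta> (Nm (\<rho> a)) = Some (W - {c})"
        using *(1) nab \<open>\<rho> a \<noteq> c\<close> by (auto simp: \<Delta>[symmetric] erase_def)
      have "erase (\<Delta>0(Cur \<mapsto> insert d W)) (Nm c) = \<Delta>(Cur \<mapsto> insert d (W - {c}))"
        using *(2) by (auto simp: \<Delta>[symmetric] erase_def)
      moreover have "ptyped P' (\<rho>(b := d, n := c)) (\<Delta>0(Cur \<mapsto> insert d W))"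
        using *(5) nab by (simp add: fun_upd_twist del: fun_upd_apply)
      ultimately have "ptyped (NuH n P') (\<rho>(b := d)) (\<Delta>(Cur \<mapsto> insert d (W - {c})))"
        using visibility_input[OF v *(1,3)] cbd unfolding ptyped_NuH by blast
      moreover have "d \<notin> \<rho> ` (fnh (NuH n P') - {b})" using *(4) by (auto simp: fnh_simps)
      ultimately show "ptyped (Inp (HIn a (FVar 0) b) (NuH n P')) \<rho> \<Delta>"
        using none W vn[OF *(3)] unfolding ptyped_HIn by blast
    qed
  next
    case (AOut a u b)
    then have nab: "n \<noteq> a" "n \<noteq> b" using n by auto
    have "\<rho> a \<noteq> c" using subj AOut c nab by blast
    from D have "ptyped (Out a (Val u) b P') (\<rho>(n := c)) \<Delta>0" by (simp add: AOut)
    then obtain V d where *: "\<Delta>0 Cur = Some V" "(\<rho>(n := c)) a \<in> V" "d \<notin> {c}" "d \<notin> vnames \<Delta>0"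
      "d \<notin> (\<rho>(n := c)) ` (fnh P' - {b})"
      "ptyped P' (\<rho>(n := c, b := d)) (\<Delta>0(Cur := None, Nm d \<mapsto> insert d V))"
      using v by (elim ptyped_OutE[where X = "{c}"]) auto
    have cbd: "c \<notin> (\<rho>(b := d)) ` (fnh P' - {n})" using cb[of b d] *(3) AOut by simp
    have V: "\<Delta> Cur = Some (V - {c})" "\<rho> a \<in> V - {c}" using Cur *(1,2) nab \<open>\<rho> a \<noteq> c\<close> by auto
    have "erase (\<Delta>0(Cur := None, Nm d \<mapsto> insert d V)) (Nm c) = \<Delta>(Cur := None, Nm d \<mapsto> insert d (V - {c}))"
      using *(3) by (auto simp: \<Delta>[symmetric] erase_def fun_eq_iff)
    moreover have "ptyped P' (\<rho>(b := d, n := c)) (\<Delta>0(Cur := None, Nm d \<mapsto> insert d V))"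
      using *(6) nab by (simp add: fun_upd_twist del: fun_upd_apply)
    ultimately have "ptyped (NuH n P') (\<rho>(b := d)) (\<Delta>(Cur := None, Nm d \<mapsto> insert d (V - {c})))"
      using visibility_output[OF v *(1,4)] cbd unfolding ptyped_NuH by blast
    moreover have "d \<notin> \<rho> ` (fnh (NuH n P') - {b})" using *(5) by (auto simp: fnh_simps)
    ultimately show ?thesis
      using V vn[OF *(4)] unfolding AOut derivative_typed.simps ptyped_Out by blast
  qed (use D plain Cur in auto)
qed

section \<open>Induction on transitions and the final statement\<close>

lemma derivative_typed_cong:
  assumes "\<And>\<rho> \<Delta>. ptyped P \<rho> \<Delta> \<longleftrightarrow> ptyped P' \<rho> \<Delta>" "fnh P = fnh P'"
  shows "derivative_typed \<mu> P \<rho> \<Delta> \<longleftrightarrow> derivative_typed \<mu> P' \<rho> \<Delta>"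
  using assms by (cases \<mu>) (auto simp: ptyped_HIn ptyped_Out)

lemma step_derivative_typed:
  "step ev P \<mu> P' \<Longrightarrow> ptyped P \<rho> \<Delta> \<Longrightarrow> visibility \<Delta> \<Longrightarrow> derivative_typed \<mu> P' \<rho> \<Delta>"
proof (induction arbitrary: \<rho> \<Delta> rule: step.induct)
  case (step_HIn b a x P v)
  then show ?case by (simp add: ptyped_HIn fnh_subst ptyped_subst)
next
  case (step_HOut e v b a P)
  then show ?case by (simp add: ptyped_Out)
next
  case (step_Bang \<alpha> P \<mu> Q)
  have Cur: "\<Delta> Cur = None" and "ptyped (Inp \<alpha> P) \<rho> \<Delta>"
    using step_Bang.prems(1) by (auto simp: ptyped_Bang)
  \<comment> \<open>A replication acts like its prefix in parallel with itself; without
    \<open>Cur\<close> both components are typed under the same \<open>\<Delta>\<close>.\<close>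
  then have "ptyped (Par (Inp \<alpha> P) (Bang \<alpha> P)) \<rho> \<Delta>"
    by (simp add: ptyped_Par ptyped_Bang fun_upd_idem)
  moreover have "bn \<mu> \<inter> fnh (Bang \<alpha> P) = {}"
    using step_input_bn[OF step_Bang.hyps] by (simp add: fnh_simps)
  ultimately show ?case
    by (intro derivative_typed_ParL[OF step_Bang.IH _ step_Bang.prems(2)])
next
  case (step_NuH P \<mu> P' n)
  show ?case
    by (rule derivative_typed_NuH[OF step_NuH.IH step_NuH.prems(1) step_NuH.hyps(2)
          step_subject_free[OF step_NuH.hyps(1)] step_fnh[OF step_NuH.hyps(1)]])
next
  case (step_NuF P \<mu> P' n)
  have "derivative_typed \<mu> P' \<rho> \<Delta>" using step_NuF.IH step_NuF.prems by (simp add: ptyped_NuF)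
  then show ?case
    using derivative_typed_cong[of "NuF n P'" P' \<mu> \<rho> \<Delta>] by (simp add: ptyped_NuF fnh_simps)
next
  case (step_ComHL P a v b P' Q Q')
  show ?case unfolding derivative_typed.simps
    by (rule ptyped_communication[OF step_ComHL.prems(2,1) step_ComHL.IH])
next
  case (step_ComHR P a v b P' Q Q')
  \<comment> \<open>The mirror image is obtained by exchanging the two components before and after
    the communication.\<close>
  have "ptyped (NuH b (Par Q' P')) \<rho> \<Delta>"
    by (rule ptyped_communication[OF step_ComHR.prems(2)
          step_ComHR.prems(1)[unfolded ptyped_Par_commute[of P Q]] step_ComHR.IH(2,1)])
  then show ?case
    unfolding derivative_typed.simps ptyped_NuH ptyped_Par_commute[of P' Q'] fnh_simps
    by (simp only: Un_commute)
next
  case (step_ComFL P h v P' Q Q')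
  show ?case unfolding derivative_typed.simps
    by (rule ptyped_first_order_communication[OF step_ComFL.prems(2,1) step_ComFL.IH])
next
  case (step_ComFR P h v P' Q Q')
  show ?case unfolding derivative_typed.simps ptyped_Par_commute[of P' Q']
    by (rule ptyped_first_order_communication[OF step_ComFR.prems(2)
          step_ComFR.prems(1)[unfolded ptyped_Par_commute[of P Q]] step_ComFR.IH(2,1)])
next
  case (step_ParL P \<mu> P' Q)
  show ?case by (rule derivative_typed_ParL[OF step_ParL.IH step_ParL.prems step_ParL.hyps(2)])
next
  case (step_ParR Q \<mu> Q' P)
  show ?case unfolding derivative_typed_Par_commute[of \<mu> P Q']
    by (rule derivative_typed_ParL[OF step_ParR.IH
          step_ParR.prems(1)[unfolded ptyped_Par_commute[of P Q]] step_ParR.prems(2) step_ParR.hyps(2)])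
qed (simp_all add: ptyped_simps ptyped_subst)

theorem mainTheorem2:
  fixes \<Delta> :: vfun
    and P P' :: "('f, 'v) proc"
    and ev :: "('f, 'v) expr \<Rightarrow> 'v \<Rightarrow> bool"
    and \<mu> :: "'v act"
  assumes "evaluation ev"
    and "visibility \<Delta>"
    and "closed_proc P"
    and "typed \<Delta> P"
    and "step ev P \<mu> P'"
  shows "(\<mu> = Tau \<or> (\<exists>h v. \<mu> = AFIn h v) \<longrightarrow> typed \<Delta> P')
    \<and> ((\<exists>h v. \<mu> = AFOut h v) \<and> Cur \<notin> dom \<Delta> \<longrightarrow> typed \<Delta> P')
    \<and> (\<forall>a v b. \<mu> = AOut a v b \<longrightarrow>
         (\<exists>V. \<Delta> Cur = Some V \<and> a \<in> V \<and>
           (b \<notin> vnames \<Delta> \<longrightarrow> typed ((erase \<Delta> Cur)(Nm b \<mapsto> V \<union> {b})) P')))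
    \<and> (\<forall>a v b. \<mu> = AIn a v b \<and> Cur \<notin> dom \<Delta> \<longrightarrow>
         (\<exists>V. \<Delta> (Nm a) = Some V \<and>
           (b \<notin> vnames \<Delta> \<longrightarrow> typed (\<Delta>(Cur \<mapsto> V \<union> {b})) P')))"
proof -
  have v: "visibility \<Delta>" and "ptyped P id \<Delta>" using assms by (simp_all add: typed_iff_ptyped)
  then have D: "derivative_typed \<mu> P' id \<Delta>" using step_derivative_typed assms(5) by blast
  \<comment> \<open>Under the identity every bound name avoids the other free names, so the witness
    can be exchanged for the action's own \<open>b\<close> once \<open>b\<close> is fresh for
    \<open>\<Delta>\<close>.\<close>
  have fresh: "b \<notin> id ` (fnh P' - {b})" for b by simp
  have out: "\<exists>V. \<Delta> Cur = Some V \<and> a \<in> V \<and>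
      (b \<notin> vnames \<Delta> \<longrightarrow> typed ((erase \<Delta> Cur)(Nm b \<mapsto> V \<union> {b})) P')" if "\<mu> = AOut a u b" for a u b
  proof -
    from D[unfolded that derivative_typed.simps ptyped_Out] obtain V c where
      *: "\<Delta> Cur = Some V" "id a \<in> V" "c \<notin> vnames \<Delta>"
      "c \<notin> id ` (fnh P' - {b})" "ptyped P' (id(b := c)) (\<Delta>(Cur := None, Nm c \<mapsto> insert c V))"
      by blast
    have "typed (\<Delta>(Cur := None, Nm b \<mapsto> insert b V)) P'" if b: "b \<notin> vnames \<Delta>"
      using ptyped_output_any[OF *(5,1,3,4) b fresh] visibility_output[OF v *(1) b]
      by (simp add: typed_iff_ptyped id_upd del: fun_upd_apply id_apply)
    with * show ?thesis by (simp add: erase_Cur)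
  qed
  have inp: "\<exists>V. \<Delta> (Nm a) = Some V \<and> (b \<notin> vnames \<Delta> \<longrightarrow> typed (\<Delta>(Cur \<mapsto> V \<union> {b})) P')"
    if "\<mu> = AIn a u b" "\<Delta> Cur = None" for a u b
  proof -
    from D[unfolded that(1) derivative_typed.simps ptyped_HIn] that(2) obtain V c where
      *: "\<Delta> (Nm (id a)) = Some V" "c \<notin> vnames \<Delta>"
      "c \<notin> id ` (fnh P' - {b})" "ptyped P' (id(b := c)) (\<Delta>(Cur \<mapsto> insert c V))"
      by blast
    have "typed (\<Delta>(Cur \<mapsto> insert b V)) P'" if b: "b \<notin> vnames \<Delta>"
      using ptyped_input_any[OF *(4,1,2,3) b fresh] visibility_input[OF v *(1) b]
      by (simp add: typed_iff_ptyped id_upd del: fun_upd_apply id_apply)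
    with * show ?thesis by simp
  qed
  show ?thesis using D v out inp by (auto simp: typed_iff_ptyped domIff)
qed

end
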